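(* Let $\Phi = (\phi_1,\dots,\phi_K) \in \mathbb{R}^{d \times K}$ be a dictionary with unit norm columns, let $H := \Phi^{\ast}\Phi - \mathbb{I}$ be its hollow Gram matrix and $\mu := \max_{i\neq j} |\langle \phi_i,\phi_j\rangle|$ its coherence. Assume that the signals $y = \Phi_I x_I$ follow the random signal model described in the context, where the support $I \subseteq \{1,\dots,K\}$ is chosen according to the rejective sampling model with probabilities $p_1,\dots,p_K$ such that $\sum_{i=1}^K p_i = S$. Let $W = \operatorname{diag}(\sqrt{p_1},\dots,\sqrt{p_K})$ be the corresponding weight matrix, and let $\varepsilon\in(0,1)$. Assume that $\|WHW\|_{2,2} \leq \frac{1}{4e^2}$. If \[ \mu \leq \frac{1}{4\log(220K/\varepsilon)} \quad\text{and}\quad \|HW\|_{\infty,2}^2 \leq \frac{1}{16e^2\log(220K/\varepsilon)}, \] then Basis Pursuit (BP) recovers the correct coefficients with probability at least $1-\varepsilon$.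
   Context: Norms: $\|A\|_{2,2}$ is the operator (spectral) norm and $\|A\|_{\infty,2}$ the maximal $\ell_2$-norm of a row of $A$. $A^{\ast}$ is the transpose, $A_I$ the submatrix with columns indexed by $I$, $\mathbb{I}$ the identity matrix. Rejective sampling model: let $p_1,\dots,p_K \in [0,1]$ with $\sum_{j} p_j = S$, $S$ a positive integer, and let $\delta_1,\dots,\delta_K$ be independent Bernoulli $0$-$1$ random variables with $\mathbb{E}\,\delta_j = p_j$. The Poisson sampling model is the law of $\{i : \delta_i = 1\}$, i.e. $\mathbb{P}(I) = \prod_{i\in I} p_i \prod_{j \notin I}(1-p_j)$. The rejective sampling model is this law conditioned on $|I| = S$, i.e. $\mathbb{P}_S(I) := \mathbb{P}(I \mid |I| = S)$. Signal model: $y = \Phi_I x_I = \sum_{k=1}^S \phi_{i_k} x_{i_k}$ with $x_{i_k} = c_k\sigma_k$ for $k = 1,\dots,S$ (and $x_i = 0$ for $i\notin I$), where $I = \{i_1,\dots,i_S\}$ is the random support drawn from the rejective sampling model, $c = (c_1,\dots,c_S)$ is an arbitrary fixed sequence of strictly positive coefficients, and $\sigma_1,\dots,\sigma_S$ are independent Rademacher signs ($\pm1$ with equal probability), independent of $I$. Basis Pursuit: solve $\hat x = \operatorname{argmin} \|z\|_1$ over $z\in\mathbb{R}^K$ subject to $y = \Phi z$. BP recovers the correct coefficients if $x$ is the unique solution of this minimisation problem. *)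

theory Defs
  imports "HOL-Analysis.Analysis" "HOL-Probability.Probability"
begin

definition hollow_gram :: "real^'k^'d \<Rightarrow> real^'k^'k" where
  "hollow_gram \<Phi> = transpose \<Phi> ** \<Phi> - mat 1"

text \<open>Inserting 0 only matters for a single column, where the maximum over the empty set
  of pairs is read as 0.\<close>

definition coherence :: "real^'k^'d \<Rightarrow> real" where
  "coherence \<Phi> = Max (insert 0 {\<bar>column i \<Phi> \<bullet> column j \<Phi>\<bar> | i j. i \<noteq> j})"

definition spectral_norm :: "real^'n^'m \<Rightarrow> real" where
  "spectral_norm A = onorm (\<lambda>x. A *v x)"

definition max_row_norm :: "real^'n^'m \<Rightarrow> real" where
  "max_row_norm A = Max (range (\<lambda>i. norm (row i A)))"

definition weight_matrix :: "('k \<Rightarrow> real) \<Rightarrow> real^'k^'k" where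
  "weight_matrix p = (\<chi> i j. if i = j then sqrt (p i) else 0)"

definition poisson_sampling :: "('k::finite \<Rightarrow> real) \<Rightarrow> 'k set pmf" where
  "poisson_sampling p =
     map_pmf (\<lambda>\<delta>. {i. \<delta> i}) (Pi_pmf UNIV False (\<lambda>i. bernoulli_pmf (p i)))"

definition rejective_sampling :: "('k::finite \<Rightarrow> real) \<Rightarrow> nat \<Rightarrow> 'k set pmf" where
  "rejective_sampling p S = cond_pmf (poisson_sampling p) {I. card I = S}"

text \<open>The value 0 is only the dummy value taken outside the index set \<open>{1..S}\<close>.\<close>

definition rademacher_signs :: "nat \<Rightarrow> (nat \<Rightarrow> real) pmf" where
  "rademacher_signs S = Pi_pmf {1..S} 0 (\<lambda>_. pmf_of_set {-1, 1})"

definition signal_model :: "('k::finite \<Rightarrow> real) \<Rightarrow> nat \<Rightarrow> ('k set \<times> (nat \<Rightarrow> real)) pmf" where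
  "signal_model p S = pair_pmf (rejective_sampling p S) (rademacher_signs S)"

text \<open>In the next two definitions \<open>\<iota> 1, \<dots>, \<iota> S\<close> enumerates the support
  and \<open>\<sigma>\<close> is the sign sequence.\<close>

definition coefficients ::
  "nat \<Rightarrow> (nat \<Rightarrow> real) \<Rightarrow> (nat \<Rightarrow> real) \<Rightarrow> (nat \<Rightarrow> 'k) \<Rightarrow> real^'k" where
  "coefficients S c \<sigma> \<iota> = (\<Sum>k = 1..S. axis (\<iota> k) (c k * \<sigma> k))"

definition signal ::
  "real^'k^'d \<Rightarrow> nat \<Rightarrow> (nat \<Rightarrow> real) \<Rightarrow> (nat \<Rightarrow> real) \<Rightarrow> (nat \<Rightarrow> 'k) \<Rightarrow> real^'d" where
  "signal \<Phi> S c \<sigma> \<iota> = (\<Sum>k = 1..S. (c k * \<sigma> k) *\<^sub>R column (\<iota> k) \<Phi>)"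

definition l1_norm :: "real^'k \<Rightarrow> real" where
  "l1_norm z = (\<Sum>i\<in>UNIV. \<bar>z $ i\<bar>)"

definition basis_pursuit :: "real^'k^'d \<Rightarrow> real^'d \<Rightarrow> (real^'k) set" where
  "basis_pursuit \<Phi> y = {x. is_arg_min l1_norm (\<lambda>z. \<Phi> *v z = y) x}"

definition bp_recovers :: "real^'k^'d \<Rightarrow> real^'d \<Rightarrow> real^'k \<Rightarrow> bool" where
  "bp_recovers \<Phi> y x \<longleftrightarrow> basis_pursuit \<Phi> y = {x}"

lemma signal_eq_coefficients:
  "signal \<Phi> S c \<sigma> \<iota> = \<Phi> *v coefficients S c \<sigma> \<iota>"
proof -
  have "\<Phi> *v axis j a = a *\<^sub>R column j \<Phi>" for j a
    by (simp add: vec_eq_iff matrix_vector_mult_def column_def axis_def if_distrib cong: if_cong)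
  then show ?thesis
    by (simp add: signal_def coefficients_def vec.sum)
qed

lemma pmf_poisson_sampling:
  assumes "\<And>i. 0 \<le> p i" "\<And>i. p i \<le> 1"
  shows "pmf (poisson_sampling p) I = (\<Prod>i\<in>I. p i) * (\<Prod>j\<in>-I. 1 - p j)"
proof -
  have inj: "inj (\<lambda>\<delta>::'a \<Rightarrow> bool. {i. \<delta> i})"
    by (auto simp: inj_def)
  have "pmf (poisson_sampling p) I =
      pmf (map_pmf (\<lambda>\<delta>. {i. \<delta> i}) (Pi_pmf UNIV False (\<lambda>i. bernoulli_pmf (p i)))) {i. i \<in> I}"
    by (simp add: poisson_sampling_def)
  also have "\<dots> = pmf (Pi_pmf UNIV False (\<lambda>i. bernoulli_pmf (p i))) (\<lambda>i. i \<in> I)"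
    using pmf_map_inj'[OF inj, of _ "\<lambda>i. i \<in> I"] by simp
  also have "\<dots> = (\<Prod>i\<in>UNIV. pmf (bernoulli_pmf (p i)) (i \<in> I))"
    by (simp add: pmf_Pi)
  also have "\<dots> = (\<Prod>i\<in>UNIV. if i \<in> I then p i else 1 - p i)"
    using assms by (intro prod.cong) auto
  also have "\<dots> = (\<Prod>i\<in>I. p i) * (\<Prod>j\<in>-I. 1 - p j)"
    by (subst prod.If_cases) auto
  finally show ?thesis .
qed

text \<open>The event conditioned on has positive probability, so \<^const>\<open>cond_pmf\<close> in
  \<^const>\<open>rejective_sampling\<close> is meaningful.\<close>

lemma poisson_sampling_card_possible:
  assumes p: "\<And>i. 0 \<le> p i" "\<And>i. p i \<le> 1" and S: "(\<Sum>i\<in>UNIV. p i) = real S"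
  shows "set_pmf (poisson_sampling p) \<inter> {I. card I = S} \<noteq> {}"
proof -
  have "real (card {i. p i = 1}) = (\<Sum>i\<in>{i. p i = 1}. p i)" by simp
  also have "\<dots> \<le> (\<Sum>i\<in>UNIV. p i)" using p by (intro sum_mono2) auto
  finally have lo: "card {i. p i = 1} \<le> S" using S by simp
  have "(\<Sum>i\<in>UNIV. p i) = (\<Sum>i\<in>{i. 0 < p i}. p i)"
    using p by (intro sum.mono_neutral_right) (auto simp: not_less intro: antisym)
  also have "\<dots> \<le> (\<Sum>i\<in>{i. 0 < p i}. 1)" using p by (intro sum_mono) auto
  finally have hi: "S \<le> card {i. 0 < p i}" using S by simp
  have sub: "{i. p i = 1} \<subseteq> {i. 0 < p i}" by auto
  obtain I where I: "{i. p i = 1} \<subseteq> I" "I \<subseteq> {i. 0 < p i}" "card I = S"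
    using exists_subset_between[OF lo hi sub] by auto
  have "(\<Prod>i\<in>I. p i) * (\<Prod>j\<in>-I. 1 - p j) > 0"
    using I p by (intro mult_pos_pos prod_pos) (auto simp: less_le)
  then have "I \<in> set_pmf (poisson_sampling p)"
    using pmf_poisson_sampling[of p I, OF p] by (metis less_irrefl set_pmf_iff)
  with I show ?thesis by auto
qed

end

theory Submission imports Defs begin

text \<open>
  Basis Pursuit recovers \<open>x\<close> as soon as some \<open>u\<close> has \<open>\<langle>\<phi>\<^sub>i, u\<rangle> = sgn x\<^sub>i\<close> on the support \<open>I\<close> and
  \<open>\<bar>\<langle>\<phi>\<^sub>j, u\<rangle>\<bar> < 1\<close> off it. If the principal submatrix of \<open>H\<close> on \<open>I\<close> has norm at most \<open>1/2\<close>, then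
  \<open>u = \<Phi> z\<close> with \<open>z = (1 + H\<^sub>I\<^sub>I)\<inverse> sgn x\<close> satisfies the first condition, and each \<open>\<langle>\<phi>\<^sub>j, u\<rangle>\<close> is a
  Rademacher sum whose coefficient vector is at most twice as long as the restriction of row \<open>j\<close> of
  \<open>H\<close> to \<open>I\<close>; Hoeffding's inequality yields the second.

  It remains to see that, with \<open>L = ln (220 K / \<epsilon>)\<close>, the event that the norm of \<open>H\<^sub>I\<^sub>I\<close> exceeds \<open>1/2\<close> or
  that some restricted row is long has probability of order \<open>K exp (- L)\<close>. This event is increasing in
  \<open>I\<close>, so passing from Poisson to rejective sampling costs only the factor \<open>1 / P(card I \<ge> S) \<le> 10\<close>:
  log-concavity of the law of \<open>card I\<close> makes the conditional probability given \<open>card I = k\<close> monotone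
  in \<open>k\<close>, and a fourth moment argument bounds \<open>P(card I \<ge> S)\<close> from below. Under Poisson sampling,
  since \<open>H\<close> is hollow, \<open>H\<^sub>I\<^sub>I\<close> is an average of off-diagonal blocks \<open>H\<^sub>A\<^sub>B\<close> with independent \<open>A\<close> and
  \<open>B\<close>, and these are controlled by applying a matrix Chernoff bound first to the rows and to the
  weighted matrix, then conditionally on \<open>A\<close>. The Chernoff bound needs no
  Golden-Thompson inequality: the effect of a rank-one perturbation \<open>s x x\<^sup>*\<close>, \<open>norm x = 1\<close>, on
  \<open>tr (exp f)\<close> lies between \<open>s\<close> and \<open>exp s - 1\<close> times \<open>\<langle>(exp f) x, x\<rangle>\<close>.
\<close>

section \<open>Rank-one perturbations of the trace exponential\<close>

text \<open>Log-convexity makes successive ratios increase. Cross-multiplication admits zeros, since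
  a vanishing term forces the next one to vanish.\<close>

lemma log_convex_ratio:
  fixes a :: "nat \<Rightarrow> real"
  assumes nn: "\<And>k. 0 \<le> a k" and lc: "\<And>k. (a (Suc k))\<^sup>2 \<le> a k * a (Suc (Suc k))"
  shows "a (Suc j) * a (j + m) \<le> a j * a (Suc (j + m))"
proof (induction m)
  case (Suc m)
  let ?k = "j + m"
  show ?case
  proof (cases "a ?k = 0")
    case True
    then have "(a (Suc ?k))\<^sup>2 \<le> 0" using lc[of ?k] by simp
    then show ?thesis using nn by simp
  next
    case False
    then have pos: "0 < a ?k" using nn[of ?k] by simp
    have "a ?k * (a (Suc j) * a (Suc ?k)) = (a (Suc j) * a ?k) * a (Suc ?k)" by simp
    also have "\<dots> \<le> (a j * a (Suc ?k)) * a (Suc ?k)"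
      by (rule mult_right_mono[OF Suc nn])
    also have "\<dots> = a j * (a (Suc ?k))\<^sup>2" by (simp add: power2_eq_square)
    also have "\<dots> \<le> a j * (a ?k * a (Suc (Suc ?k)))"
      by (rule mult_left_mono[OF lc nn])
    also have "\<dots> = a ?k * (a j * a (Suc (Suc ?k)))" by simp
    finally show ?thesis using pos by simp
  qed
qed simp

text \<open>Moving one unit from the smaller index to the larger does not decrease the product;
  repeating this ends at \<open>a 0 = 1\<close>.\<close>

lemma log_convex_supermultiplicative:
  fixes a :: "nat \<Rightarrow> real"
  assumes nn: "\<And>k. 0 \<le> a k" and lc: "\<And>k. (a (Suc k))\<^sup>2 \<le> a k * a (Suc (Suc k))" and a0: "a 0 = 1"
  shows "a k * a l \<le> a (k + l)"
proof -
  have *: "a k * a l \<le> a (k + l)" if "k \<le> l" for k l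
    using that
  proof (induction k arbitrary: l)
    case (Suc k)
    have "a (Suc k) * a l \<le> a k * a (Suc l)"
      using log_convex_ratio[of a k "l - k", OF nn lc] Suc.prems by simp
    also have "\<dots> \<le> a (Suc k + l)" using Suc.IH[of "Suc l"] Suc.prems by simp
    finally show ?case .
  qed (simp add: a0)
  show ?thesis
    using *[of k l] *[of l k] by (cases "k \<le> l") (auto simp: mult.commute add.commute)
qed

section \<open>Positive semidefinite operators and their moments\<close>

definition psd :: "('a::euclidean_space \<Rightarrow> 'a) \<Rightarrow> bool" where
  "psd f \<longleftrightarrow> linear f \<and> (\<forall>x y. f x \<bullet> y = x \<bullet> f y) \<and> (\<forall>x. 0 \<le> f x \<bullet> x)"

definition tr :: "('a::euclidean_space \<Rightarrow> 'a) \<Rightarrow> real" where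
  "tr f = (\<Sum>b\<in>Basis. f b \<bullet> b)"

text \<open>The trace of the exponential of \<open>f\<close>, defined through traces of powers so
  that no operator exponential has to be formed.\<close>

definition trexp :: "('a::euclidean_space \<Rightarrow> 'a) \<Rightarrow> real" where
  "trexp f = (\<Sum>n. tr (f ^^ n) / fact n)"

definition rank1 :: "'a::euclidean_space \<Rightarrow> 'a \<Rightarrow> 'a" where
  "rank1 x y = (x \<bullet> y) *\<^sub>R x"

lemma psd_linear: "psd f \<Longrightarrow> linear f" by (simp add: psd_def)
lemma psd_sym: "psd f \<Longrightarrow> f x \<bullet> y = x \<bullet> f y" by (simp add: psd_def)
lemma psd_nonneg: "psd f \<Longrightarrow> 0 \<le> f x \<bullet> x" by (auto simp only: psd_def)

lemma psd_zero: "psd (\<lambda>x. 0)"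
  by (simp add: psd_def linear_zero)

lemma psd_add_rank1: "psd f \<Longrightarrow> 0 \<le> s \<Longrightarrow> psd (\<lambda>y. f y + s *\<^sub>R rank1 x y)"
  unfolding psd_def rank1_def
  by (auto simp: linear_iff inner_simps algebra_simps inner_commute intro!: add_nonneg_nonneg)

lemma funpow_linear: "linear f \<Longrightarrow> linear (f ^^ n)" for f :: "'a::real_vector \<Rightarrow> 'a"
proof (induction n)
  case (Suc n)
  then show ?case using linear_compose[of "f ^^ n" f] by (simp add: o_def)
qed (simp add: linear_id[unfolded id_def] id_def)

lemma psd_funpow_sym:
  assumes "psd f" shows "(f ^^ n) x \<bullet> y = x \<bullet> (f ^^ n) y"
proof (induction n arbitrary: x y)
  case (Suc n)
  have "(f ^^ Suc n) x \<bullet> y = (f ^^ n) x \<bullet> f y" using psd_sym[OF assms] by simp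
  also have "\<dots> = x \<bullet> (f ^^ n) (f y)" by (rule Suc)
  finally show ?case by (simp only: funpow_Suc_right o_def)
qed simp

text \<open>Symmetry moves one factor across: the quadratic form of \<open>f ^^ Suc (Suc m)\<close>
  at \<open>x\<close> is that of \<open>f ^^ m\<close> at \<open>f x\<close>, so the induction
  descends by two.\<close>

lemma psd_funpow_nonneg:
  assumes "psd f" shows "0 \<le> (f ^^ n) x \<bullet> x"
proof (induction n arbitrary: x rule: nat_less_induct)
  case (1 n)
  consider "n = 0" | "n = 1" | m where "n = Suc (Suc m)" by (metis One_nat_def not0_implies_Suc)
  then show ?case
  proof cases
    case 3
    have "(f ^^ n) x \<bullet> x = f ((f ^^ m) (f x)) \<bullet> x"
      unfolding 3 by (simp add: funpow_swap1)
    then have "(f ^^ n) x \<bullet> x = (f ^^ m) (f x) \<bullet> f x"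
      using psd_sym[OF assms] by simp
    then show ?thesis using 1 3 by simp
  qed (simp_all add: psd_nonneg[OF assms])
qed

lemma psd_funpow: "psd f \<Longrightarrow> psd (f ^^ n)"
  unfolding psd_def[of "f ^^ n"]
  by (intro conjI allI funpow_linear psd_linear psd_funpow_sym psd_funpow_nonneg)

text \<open>The quadratic in \<open>q\<close> is nonnegative for all \<open>t\<close>, so its
  discriminant is not positive; a vanishing leading coefficient needs its own case.\<close>

lemma psd_cauchy_schwarz:
  assumes "psd f" shows "(f x \<bullet> y)\<^sup>2 \<le> (f x \<bullet> x) * (f y \<bullet> y)"
proof -
  have lin: "linear f" using assms by (rule psd_linear)
  have q: "0 \<le> (f x \<bullet> x) * t\<^sup>2 + 2 * (f x \<bullet> y) * t + (f y \<bullet> y)" for t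
  proof -
    have "0 \<le> f (t *\<^sub>R x + y) \<bullet> (t *\<^sub>R x + y)" by (rule psd_nonneg[OF assms])
    also have "\<dots> = (f x \<bullet> x) * t\<^sup>2 + 2 * (f x \<bullet> y) * t + (f y \<bullet> y)"
      using psd_sym[OF assms, of y x]
      by (simp add: linear_add[OF lin] linear_scale[OF lin] inner_simps power2_eq_square
          algebra_simps inner_commute)
    finally show ?thesis .
  qed
  let ?a = "f x \<bullet> x" and ?b = "f x \<bullet> y" and ?c = "f y \<bullet> y"
  show ?thesis
  proof (cases "?a = 0")
    case True
    have "?b = 0"
    proof (rule ccontr)
      assume b: "?b \<noteq> 0"
      \<comment> \<open>At this \<open>t\<close> the affine function \<open>2 * ?b * t + ?c\<close>
        equals -1.\<close>
      have "0 \<le> 2 * ?b * (- (?c + 1) / (2 * ?b)) + ?c" using q[of "- (?c + 1) / (2 * ?b)"] True by simp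
      then show False using b by simp
    qed
    then show ?thesis using True by simp
  next
    case False
    then have a: "0 < ?a" using psd_nonneg[OF assms, of x] by simp
    have "0 \<le> ?a * (- ?b / ?a)\<^sup>2 + 2 * ?b * (- ?b / ?a) + ?c" by (rule q)
    also have "\<dots> = ?c - ?b\<^sup>2 / ?a" using a by (simp add: field_simps power2_eq_square)
    finally show ?thesis using a by (simp add: field_simps)
  qed
qed

text \<open>Cauchy-Schwarz for the form of \<open>f ^^ k\<close>, applied to \<open>x\<close> and
  \<open>f x\<close>.\<close>

lemma funpow_moment_log_convex:
  assumes "psd f"
  shows "((f ^^ Suc k) x \<bullet> x)\<^sup>2 \<le> ((f ^^ k) x \<bullet> x) * ((f ^^ Suc (Suc k)) x \<bullet> x)"
proof -
  have 1: "(f ^^ k) x \<bullet> f x = (f ^^ Suc k) x \<bullet> x" using psd_sym[OF assms] by simp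
  have 2: "(f ^^ k) (f x) \<bullet> f x = (f ^^ Suc (Suc k)) x \<bullet> x"
    using psd_sym[OF assms, of "(f ^^ k) (f x)" x] by (simp add: funpow_swap1)
  show ?thesis
    using psd_cauchy_schwarz[OF psd_funpow[OF assms], of k x "f x"] unfolding 1 2 .
qed

lemma funpow_moment_supermultiplicative:
  assumes "psd f" "norm x = 1"
  shows "((f ^^ k) x \<bullet> x) * ((f ^^ l) x \<bullet> x) \<le> (f ^^ (k + l)) x \<bullet> x"
  by (rule log_convex_supermultiplicative)
    (use assms in \<open>auto simp: psd_funpow_nonneg funpow_moment_log_convex norm_eq_1 simp del: funpow.simps(2)\<close>)

section \<open>Power series for the trace exponential\<close>

lemma norm_funpow_le:
  fixes f :: "'a::real_normed_vector \<Rightarrow> 'a"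
  assumes "\<And>x. norm (f x) \<le> B * norm x" "0 \<le> B"
  shows "norm ((f ^^ n) x) \<le> B ^ n * norm x"
proof (induction n)
  case (Suc n)
  have "norm ((f ^^ Suc n) x) \<le> B * norm ((f ^^ n) x)" by (simp add: assms(1))
  also have "\<dots> \<le> B * (B ^ n * norm x)" using Suc assms(2) by (rule mult_left_mono)
  finally show ?case by (simp add: mult.assoc)
qed simp

lemma linear_norm_bound:
  fixes f :: "'a::euclidean_space \<Rightarrow> 'b::real_normed_vector"
  assumes "linear f"
  obtains B where "0 \<le> B" "\<And>x. norm (f x) \<le> B * norm x"
  proof -
  obtain B where B: "B > 0" "\<And>x. norm (f x) \<le> B * norm x" using linear_bounded_pos[OF assms] by blast
  then show ?thesis using that[of B] by simp
qed

lemma abs_funpow_inner_le: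
  fixes f :: "'a::euclidean_space \<Rightarrow> 'a"
  assumes "\<And>x. norm (f x) \<le> B * norm x" "0 \<le> B" "norm x = 1"
  shows "\<bar>(f ^^ n) x \<bullet> x\<bar> \<le> B ^ n"
proof -
  have "\<bar>(f ^^ n) x \<bullet> x\<bar> \<le> norm ((f ^^ n) x) * norm x" by (rule Cauchy_Schwarz_ineq2)
  also have "\<dots> \<le> B ^ n" using norm_funpow_le[of f B n x] assms by simp
  finally show ?thesis .
qed

lemma summable_power_fact: "summable (\<lambda>n. B ^ n / fact n :: real)"
  using summable_exp[of B] by (simp add: field_simps)

lemma suminf_power_fact: "(\<Sum>n. B ^ n / fact n :: real) = exp B"
  by (simp add: exp_def divide_inverse mult.commute)

lemma summable_funpow_moments:
  fixes f :: "'a::euclidean_space \<Rightarrow> 'a"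
  assumes "linear f" "norm x = 1"
  shows "summable (\<lambda>n. ((f ^^ n) x \<bullet> x) / fact n)"
proof -
  obtain B where B: "0 \<le> B" "\<And>x. norm (f x) \<le> B * norm x" using linear_norm_bound[OF assms(1)] by blast
  show ?thesis
    by (rule summable_comparison_test'[OF summable_power_fact[of B], of 0])
      (use abs_funpow_inner_le[OF B(2,1) assms(2)] in \<open>simp add: divide_right_mono\<close>)
qed

lemma summable_trexp:
  assumes "linear f" shows "summable (\<lambda>n. tr (f ^^ n) / fact n)"
  unfolding tr_def sum_divide_distrib
  by (rule summable_sum, rule summable_funpow_moments[OF assms]) simp

lemma trexp_le:
  fixes f :: "'a::euclidean_space \<Rightarrow> 'a"
  assumes "linear f" "\<And>x. norm (f x) \<le> B * norm x" "0 \<le> B"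
  shows "trexp f \<le> DIM('a) * exp B"
proof -
  have "tr (f ^^ n) \<le> (\<Sum>b\<in>(Basis::'a set). B ^ n)" for n
    unfolding tr_def
    by (rule sum_mono, rule abs_le_D1[OF abs_funpow_inner_le[OF assms(2,3)]]) simp
  then have "trexp f \<le> (\<Sum>n. DIM('a) * (B ^ n / fact n))"
    unfolding trexp_def
    by (intro suminf_le[OF _ summable_trexp[OF assms(1)] summable_mult[OF summable_power_fact]])
      (simp add: divide_right_mono)
  also have "\<dots> = DIM('a) * exp B"
    by (simp only: suminf_mult[OF summable_power_fact] suminf_power_fact)
  finally show ?thesis .
qed

lemma sum_Basis_inner: "(\<Sum>b\<in>Basis. (u \<bullet> b) * (v \<bullet> b)) = u \<bullet> (v::'a::euclidean_space)"
  by (rule euclidean_inner[symmetric])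

text \<open>Here \<open>mixed l k = \<langle>g\<^sup>l x, f\<^sup>k x\<rangle>\<close> for \<open>g = f + s x x\<^sup>*\<close>. Its recursion contains the product
  \<open>mom k * mixed l 0\<close>; replacing that by \<open>mixed l k\<close> gives the linear recursion of \<open>bound\<close>, which
  dominates \<open>mixed\<close> because the moments are supermultiplicative.\<close>

context
  fixes f :: "'a::euclidean_space \<Rightarrow> 'a" and x :: 'a and s :: real
  assumes f: "psd f" and x: "norm x = 1" and s: "0 \<le> s"
begin

definition pert :: "'a \<Rightarrow> 'a" where "pert y = f y + s *\<^sub>R rank1 x y"

definition mom :: "nat \<Rightarrow> real" where "mom n = (f ^^ n) x \<bullet> x"

definition mixed :: "nat \<Rightarrow> nat \<Rightarrow> real" where "mixed l k = (pert ^^ l) x \<bullet> (f ^^ k) x"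

primrec bound :: "nat \<Rightarrow> nat \<Rightarrow> real" where
  "bound 0 k = mom k"
| "bound (Suc l) k = bound l (Suc k) + s * bound l k"

lemma psd_pert: "psd pert"
  using psd_add_rank1[OF f s, of x] by (simp add: pert_def[abs_def])

lemma mom_nonneg: "0 \<le> mom n"
  by (simp add: mom_def psd_funpow_nonneg[OF f])

lemma mom_supermultiplicative: "mom k * mom l \<le> mom (k + l)"
  unfolding mom_def by (rule funpow_moment_supermultiplicative[OF f x])

lemma mixed_0: "mixed 0 k = mom k"
  by (simp add: mixed_def mom_def inner_commute)

lemma mixed_Suc: "mixed (Suc l) k = mixed l (Suc k) + s * (mom k * mixed l 0)"
proof -
  have "mixed (Suc l) k = f ((pert ^^ l) x) \<bullet> (f ^^ k) x + s * ((x \<bullet> (pert ^^ l) x) * (x \<bullet> (f ^^ k) x))"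
    unfolding mixed_def funpow.simps o_def pert_def[of "(pert ^^ l) x"] rank1_def
    by (simp add: inner_simps)
  then show ?thesis
    by (simp add: mixed_def mom_def psd_sym[OF f] inner_commute mult.commute)
qed

lemma mixed_ge: "mom (k + l) \<le> mixed l k"
proof (induction l arbitrary: k)
  case (Suc l)
  have "0 \<le> mixed l 0" using Suc[of 0] mom_nonneg[of l] by simp
  then have "0 \<le> s * (mom k * mixed l 0)" using s mom_nonneg[of k] by simp
  then show ?case using Suc[of "Suc k"] by (simp add: mixed_Suc)
qed (simp add: mixed_0)

text \<open>Only the base case uses that the moments are supermultiplicative; the recursion of
  \<open>bound\<close> is linear, so the factor \<open>mom k\<close> passes through it.\<close>

lemma bound_shift: "mom k * bound l m \<le> bound l (m + k)"
proof (induction l arbitrary: m)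
  case 0
  show ?case using mom_supermultiplicative[of k m] by (simp add: add.commute)
next
  case (Suc l)
  have "mom k * bound (Suc l) m = mom k * bound l (Suc m) + s * (mom k * bound l m)"
    by (simp add: algebra_simps)
  also have "\<dots> \<le> bound l (Suc m + k) + s * bound l (m + k)"
    by (intro add_mono mult_left_mono Suc s)
  finally show ?case by simp
qed

lemma mixed_le: "mixed l k \<le> bound l k"
proof (induction l arbitrary: k)
  case (Suc l)
  have "mom k * mixed l 0 \<le> mom k * bound l 0"
    using Suc mom_nonneg by (intro mult_left_mono)
  also have "\<dots> \<le> bound l k" using bound_shift[of k l 0] by simp
  finally show ?case using Suc[of "Suc k"] s by (simp add: mixed_Suc add_mono mult_left_mono)
qed (simp add: mixed_0)

text \<open>The recursion applies the sum of an index shift and a multiplication by \<open>s\<close>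
  to the moments \<open>l\<close> times, and these two operations commute.\<close>

lemma bound_binomial: "bound l k = (\<Sum>j\<le>l. real (l choose j) * s ^ j * mom (k + (l - j)))"
proof (induction l arbitrary: k)
  case (Suc l)
  let ?t = "\<lambda>j. s ^ j * mom (k + (Suc l - j))"
  have A: "bound l (Suc k) = (\<Sum>j\<le>l. real (l choose j) * ?t j)"
    unfolding Suc by (intro sum.cong) (auto simp: Suc_diff_le)
  \<comment> \<open>The binomial coefficient at \<open>j = Suc l\<close> is zero, so the sum may be
    extended to \<open>Suc l\<close> and shifted for Pascal's rule.\<close>
  have A': "(\<Sum>j\<le>l. real (l choose j) * ?t j) = ?t 0 + (\<Sum>j\<le>l. real (l choose Suc j) * ?t (Suc j))"
  proof -
    have "(\<Sum>j\<le>l. real (l choose j) * ?t j) = (\<Sum>j\<le>Suc l. real (l choose j) * ?t j)" by simp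
    also have "\<dots> = ?t 0 + (\<Sum>j\<le>l. real (l choose Suc j) * ?t (Suc j))"
      by (subst sum.atMost_Suc_shift) simp
    finally show ?thesis .
  qed
  have B: "s * bound l k = (\<Sum>j\<le>l. real (l choose j) * ?t (Suc j))"
    unfolding Suc by (simp add: sum_distrib_left mult_ac)
  have "(\<Sum>j\<le>Suc l. real (Suc l choose j) * ?t j)
      = ?t 0 + (\<Sum>j\<le>l. (real (l choose j) + real (l choose Suc j)) * ?t (Suc j))"
    by (subst sum.atMost_Suc_shift) simp
  also have "\<dots> = bound (Suc l) k"
    using A A' B by (simp add: distrib_right sum.distrib)
  finally show ?case by (simp add: mult.assoc)
qed simp

lemma mom_summable: "summable (\<lambda>n. mom n / fact n)"
  unfolding mom_def by (rule summable_funpow_moments[OF psd_linear[OF f] x])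

text \<open>By the binomial formula this is the Cauchy product of the series for
  \<open>exp s\<close> with the moment series, whose sum is the quadratic form of the exponential of
  \<open>f\<close> at \<open>x\<close>.\<close>

lemma bound_sums: "(\<lambda>n. bound n 0 / fact n) sums (exp s * (\<Sum>n. mom n / fact n))"
proof -
  have a: "summable (\<lambda>n. norm (s ^ n / fact n))"
    using s summable_power_fact[of s] by simp
  have b: "summable (\<lambda>n. norm (mom n / fact n))"
    using mom_nonneg mom_summable by simp
  have "(\<lambda>n. \<Sum>i\<le>n. (s ^ i / fact i) * (mom (n - i) / fact (n - i)))
     sums ((\<Sum>n. s ^ n / fact n) * (\<Sum>n. mom n / fact n))"
    by (rule Cauchy_product_sums[OF a b])
  moreover have "(\<Sum>i\<le>n. (s ^ i / fact i) * (mom (n - i) / fact (n - i))) = bound n 0 / fact n" for n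
    unfolding bound_binomial sum_divide_distrib
    by (intro sum.cong refl) (simp add: binomial_fact)
  ultimately show ?thesis by (simp add: suminf_power_fact)
qed

text \<open>Turning one factor \<open>pert\<close> into \<open>f\<close> leaves the trace of a
  rank-one operator, which is an inner product.\<close>

lemma tr_telescope_step:
  "tr (\<lambda>y. (pert ^^ Suc l) ((f ^^ k) y)) - tr (\<lambda>y. (pert ^^ l) ((f ^^ Suc k) y)) = s * mixed l k"
proof -
  have lin: "linear (pert ^^ l)" using psd_pert by (intro funpow_linear psd_linear)
  have eq: "(pert ^^ Suc l) z = (pert ^^ l) (f z) + (s * (x \<bullet> z)) *\<^sub>R (pert ^^ l) x" for z
    by (simp only: funpow_Suc_right o_def pert_def[of z] rank1_def linear_add[OF lin] linear_scale[OF lin] scaleR_scaleR)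
  have "tr (\<lambda>y. (pert ^^ Suc l) ((f ^^ k) y)) - tr (\<lambda>y. (pert ^^ l) ((f ^^ Suc k) y))
     = (\<Sum>b\<in>Basis. s * ((x \<bullet> (f ^^ k) b) * ((pert ^^ l) x \<bullet> b)))"
    unfolding tr_def sum_subtractf[symmetric] eq by (simp add: inner_simps mult.assoc)
  also have "\<dots> = s * (\<Sum>b\<in>Basis. (((f ^^ k) x \<bullet> b) * ((pert ^^ l) x \<bullet> b)))"
    by (simp add: sum_distrib_left psd_funpow_sym[OF f])
  also have "\<dots> = s * mixed l k"
    unfolding sum_Basis_inner mixed_def by (simp add: inner_commute)
  finally show ?thesis .
qed

text \<open>Telescoping along the words \<open>pert ^^ (n - k)\<close> times \<open>f ^^ k\<close>,
  with one factor replaced at a time.\<close>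

lemma tr_pert_diff: "tr (pert ^^ n) - tr (f ^^ n) = s * (\<Sum>k<n. mixed (n - Suc k) k)"
proof -
  let ?u = "\<lambda>k. tr (\<lambda>y. (pert ^^ (n - k)) ((f ^^ k) y))"
  have "(\<Sum>k<n. ?u (Suc k) - ?u k) = ?u n - ?u 0" by (rule sum_lessThan_telescope)
  moreover have "?u (Suc k) - ?u k = - (s * mixed (n - Suc k) k)" if "k < n" for k
    using tr_telescope_step[of "n - Suc k" k] that by (simp add: Suc_diff_Suc)
  moreover have "?u n = tr (f ^^ n)" "?u 0 = tr (pert ^^ n)" by simp_all
  ultimately show ?thesis by (simp add: sum_negf sum_distrib_left)
qed

text \<open>After replacing \<open>mixed\<close> by \<open>bound\<close> the error terms telescope
  again: by the recursion each is a difference of two values of \<open>bound\<close> with index sum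
  \<open>n\<close>.\<close>

lemma tr_pert_upper: "tr (pert ^^ n) - tr (f ^^ n) \<le> bound n 0 - mom n"
proof -
  have "s * (\<Sum>k<n. mixed (n - Suc k) k) \<le> (\<Sum>k<n. s * bound (n - Suc k) k)"
    unfolding sum_distrib_left using s mixed_le by (intro sum_mono mult_left_mono)
  also have "\<dots> = (\<Sum>k<n. bound (n - k) k - bound (n - Suc k) (Suc k))"
  proof (intro sum.cong refl)
    fix k assume "k \<in> {..<n}"
    then show "s * bound (n - Suc k) k = bound (n - k) k - bound (n - Suc k) (Suc k)"
      using bound.simps(2)[of "n - Suc k" k] by (simp add: Suc_diff_Suc)
  qed
  also have "\<dots> = bound n 0 - bound 0 n"
    using sum_lessThan_telescope'[of "\<lambda>k. bound (n - k) k" n] by simp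
  finally show ?thesis by (simp add: tr_pert_diff)
qed

text \<open>By \<open>mixed_ge\<close> each of the \<open>n\<close> summands is at least
  \<open>mom (n - 1)\<close>; this is the first-order part of the effect.\<close>

lemma tr_pert_lower: "s * (real n * mom (n - 1)) \<le> tr (pert ^^ n) - tr (f ^^ n)"
proof -
  have "(\<Sum>k<n. mom (n - 1)) \<le> (\<Sum>k<n. mixed (n - Suc k) k)"
    by (intro sum_mono order_trans[OF _ mixed_ge]) simp
  then show ?thesis using s by (simp add: tr_pert_diff mult_left_mono)
qed

lemma tr_diff_summable: "summable (\<lambda>n. (tr (pert ^^ n) - tr (f ^^ n)) / fact n)"
  unfolding diff_divide_distrib
  by (rule summable_diff; rule summable_trexp; rule psd_linear; rule psd_pert f)

lemma trexp_pert_upper: "trexp pert \<le> trexp f + (exp s - 1) * (\<Sum>n. mom n / fact n)"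
proof -
  have "trexp pert - trexp f = (\<Sum>n. (tr (pert ^^ n) - tr (f ^^ n)) / fact n)"
    unfolding trexp_def diff_divide_distrib
    by (rule suminf_diff; rule summable_trexp; rule psd_linear; rule psd_pert f)
  also have "\<dots> \<le> (\<Sum>n. bound n 0 / fact n - mom n / fact n)"
    unfolding diff_divide_distrib[symmetric]
    by (rule suminf_le[OF divide_right_mono[OF tr_pert_upper] tr_diff_summable])
      (use summable_diff[OF sums_summable[OF bound_sums] mom_summable] in \<open>simp_all add: diff_divide_distrib\<close>)
  also have "\<dots> = exp s * (\<Sum>n. mom n / fact n) - (\<Sum>n. mom n / fact n)"
    using suminf_diff[OF sums_summable[OF bound_sums] mom_summable] sums_unique[OF bound_sums] by simp
  finally show ?thesis by (simp add: algebra_simps)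
qed

lemma trexp_pert_lower: "trexp f + s * (\<Sum>n. mom n / fact n) \<le> trexp pert"
proof -
  have eq: "real (Suc n) * mom (Suc n - 1) / fact (Suc n) = mom n / fact n" for n
  proof -
    have "real (Suc n) * mom (Suc n - 1) / fact (Suc n) = (real (Suc n) * mom n) / (real (Suc n) * fact n)"
      by (simp only: fact_Suc of_nat_mult diff_Suc_1)
    then show ?thesis by (simp only: mult_divide_mult_cancel_left of_nat_eq_0_iff nat.simps not_False_eq_True)
  qed
  have "(\<lambda>n. s * (real (Suc n) * mom (Suc n - 1)) / fact (Suc n)) sums (s * (\<Sum>n. mom n / fact n))"
    using sums_mult[OF summable_sums[OF mom_summable], of s] unfolding eq[symmetric] times_divide_eq_right .
  \<comment> \<open>The term \<open>n = 0\<close> carries the factor \<open>real n\<close>, so the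
    truncated \<open>n - 1\<close> there is harmless.\<close>
  then have sm: "(\<lambda>n. s * (real n * mom (n - 1)) / fact n) sums (s * (\<Sum>n. mom n / fact n))"
    by (rule sums_Suc_imp[rotated]) simp
  have "s * (\<Sum>n. mom n / fact n) = (\<Sum>n. s * (real n * mom (n - 1)) / fact n)"
    by (rule sums_unique[OF sm])
  also have "\<dots> \<le> (\<Sum>n. (tr (pert ^^ n) - tr (f ^^ n)) / fact n)"
    by (rule suminf_le[OF divide_right_mono[OF tr_pert_lower] sums_summable[OF sm] tr_diff_summable]) simp
  also have "\<dots> = trexp pert - trexp f"
    unfolding trexp_def diff_divide_distrib
    by (rule suminf_diff[symmetric]; rule summable_trexp; rule psd_linear; rule psd_pert f)
  finally show ?thesis by simp
qed

lemma mom_suminf_nonneg: "0 \<le> (\<Sum>n. mom n / fact n)"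
  by (rule suminf_nonneg[OF mom_summable]) (simp add: mom_nonneg)

end

section \<open>Finite expectations under Poisson sampling\<close>

text \<open>Expectation over Poisson sampling from \<open>A\<close> as a finite sum. The ground set
  is a parameter so that arguments can add its elements one by one, by
  \<open>PE_insert\<close>.\<close>

definition PE :: "('i \<Rightarrow> real) \<Rightarrow> 'i set \<Rightarrow> ('i set \<Rightarrow> real) \<Rightarrow> real" where
  "PE p A f = (\<Sum>I\<in>Pow A. (\<Prod>i\<in>I. p i) * (\<Prod>i\<in>A - I. 1 - p i) * f I)"

lemma PE_empty [simp]: "PE p {} f = f {}"
  by (simp add: PE_def)

lemma PE_insert:
  assumes "finite A" "a \<notin> A"
  shows "PE p (insert a A) f = p a * PE p A (\<lambda>I. f (insert a I)) + (1 - p a) * PE p A f"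
proof -
  have disj: "Pow A \<inter> insert a ` Pow A = {}" using assms by auto
  have inj: "inj_on (insert a) (Pow A)" using assms by (auto simp: inj_on_def insert_eq_iff)
  have 1: "(\<Prod>i\<in>insert a I. p i) * (\<Prod>i\<in>insert a A - insert a I. 1 - p i) * f (insert a I)
      = p a * ((\<Prod>i\<in>I. p i) * (\<Prod>i\<in>A - I. 1 - p i) * f (insert a I))" if "I \<in> Pow A" for I
  proof -
    have "insert a A - insert a I = A - I" using assms that by auto
    moreover have "(\<Prod>i\<in>insert a I. p i) = p a * (\<Prod>i\<in>I. p i)"
      using assms that finite_subset by (subst prod.insert) auto
    ultimately show ?thesis by simp
  qed
  have 2: "(\<Prod>i\<in>I. p i) * (\<Prod>i\<in>insert a A - I. 1 - p i) * f I
      = (1 - p a) * ((\<Prod>i\<in>I. p i) * (\<Prod>i\<in>A - I. 1 - p i) * f I)" if "I \<in> Pow A" for I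
  proof -
    have "insert a A - I = insert a (A - I)" using assms that by auto
    then show ?thesis using assms by simp
  qed
  show ?thesis
    unfolding PE_def Pow_insert sum_distrib_left using assms disj
    by (subst sum.union_disjoint, simp_all only: finite_Pow_iff finite_imageI sum.reindex[OF inj] o_def)
      (simp only: 1 2 add.commute cong: sum.cong)
qed

lemma PE_mono:
  assumes "\<And>i. i \<in> A \<Longrightarrow> 0 \<le> p i" "\<And>i. i \<in> A \<Longrightarrow> p i \<le> 1" "\<And>I. I \<subseteq> A \<Longrightarrow> f I \<le> g I"
  shows "PE p A f \<le> PE p A g"
  unfolding PE_def using assms
  by (intro sum_mono mult_left_mono mult_nonneg_nonneg prod_nonneg) auto

lemma PE_cong: "(\<And>I. I \<subseteq> A \<Longrightarrow> f I = g I) \<Longrightarrow> PE p A f = PE p A g"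
  unfolding PE_def by (intro sum.cong) auto

lemma PE_add: "PE p A (\<lambda>I. f I + g I) = PE p A f + PE p A g"
  by (simp add: PE_def distrib_left sum.distrib)

lemma PE_diff: "PE p A (\<lambda>I. f I - g I) = PE p A f - PE p A g"
  by (simp add: PE_def right_diff_distrib sum_subtractf)

lemma PE_cmult: "PE p A (\<lambda>I. c * f I) = c * PE p A f"
  by (simp add: PE_def sum_distrib_left mult_ac)

lemma PE_const: "finite A \<Longrightarrow> PE p A (\<lambda>I. c) = c"
  by (induction A rule: finite_induct) (simp_all add: PE_insert algebra_simps)

lemma PE_sum: "PE p A (\<lambda>I. \<Sum>x\<in>X. f x I) = (\<Sum>x\<in>X. PE p A (f x))"
  unfolding PE_def sum_distrib_left by (rule sum.swap)

lemma PE_nonneg: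
  assumes "\<And>i. i \<in> A \<Longrightarrow> 0 \<le> p i" "\<And>i. i \<in> A \<Longrightarrow> p i \<le> 1" "\<And>I. I \<subseteq> A \<Longrightarrow> 0 \<le> f I"
  shows "0 \<le> PE p A f"
  unfolding PE_def using assms
  by (intro sum_nonneg mult_nonneg_nonneg prod_nonneg) auto

lemma PE_swap: "PE p A (\<lambda>I. PE q B (\<lambda>J. f I J)) = PE q B (\<lambda>J. PE p A (\<lambda>I. f I J))"
  unfolding PE_def sum_distrib_left by (subst sum.swap) (simp add: mult_ac)

section \<open>A matrix Chernoff bound\<close>

text \<open>Convexity puts \<open>exp\<close> below its chord. The interval from 0 to 2 is the range
  of the exponents \<open>2 / M * (norm x)\<^sup>2\<close>.\<close>

lemma exp_chord:
  fixes s :: real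
  assumes "0 \<le> s" "s \<le> 2" shows "exp s - 1 \<le> s * (exp 2 - 1) / 2"
proof -
  have "exp ((1 - s / 2) * 0 + (s / 2) * 2) \<le> (1 - s / 2) * exp 0 + (s / 2) * exp (2::real)"
    using convex_onD[OF exp_convex, of "s / 2" 0 2] assms by simp
  then show ?thesis by (simp add: field_simps)
qed

lemma rank1_unit: "rank1 x y = (norm x)\<^sup>2 *\<^sub>R rank1 (x /\<^sub>R norm x) y"
  by (cases "x = 0") (auto simp: rank1_def power2_eq_square field_simps)

text \<open>Both effects are multiples of the same number \<open>E\<close>: the Bernoulli summand
  raises the mean by at most \<open>p * (exp s - 1) * E\<close>, the deterministic one of weight
  \<open>r\<close> by at least \<open>r * E\<close>. The chord bound gives
  \<open>p * (exp s - 1) \<le> r\<close>.\<close>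

lemma trexp_bernoulli_step:
  assumes f: "psd f" and M: "0 < M" and x: "(norm x)\<^sup>2 \<le> M" and p: "0 \<le> p"
  shows "p * trexp (\<lambda>y. f y + (2 / M) *\<^sub>R rank1 x y) + (1 - p) * trexp f
    \<le> trexp (\<lambda>y. f y + (p * exp 2 / M) *\<^sub>R rank1 x y)"
proof (cases "x = 0")
  case True
  then show ?thesis by (simp add: rank1_def algebra_simps)
next
  case False
  define u where "u = x /\<^sub>R norm x"
  define s where "s = 2 / M * (norm x)\<^sup>2"
  define r where "r = p * exp 2 / M * (norm x)\<^sup>2"
  define E where "E = (\<Sum>n. mom f u n / fact n)"
  have u: "norm u = 1" using False by (simp add: u_def)
  have s: "0 \<le> s" "s \<le> 2" using M x by (auto simp: s_def field_simps)
  have r: "0 \<le> r" using M p by (simp add: r_def)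
  have eq: "(\<lambda>y. f y + c *\<^sub>R rank1 x y) = pert f u (c * (norm x)\<^sup>2)" if "0 \<le> c * (norm x)\<^sup>2" for c
    by (simp add: fun_eq_iff rank1_unit[of x] pert_def[OF f u that] u_def[symmetric])
  have E: "0 \<le> E" unfolding E_def by (rule mom_suminf_nonneg[OF f u s(1)])
  have "p * (exp s - 1) \<le> p * (s * (exp 2 - 1) / 2)" by (intro mult_left_mono exp_chord s p)
  also have "\<dots> \<le> r"
  proof -
    have "s * (exp 2 - 1) \<le> s * exp 2" using s by (intro mult_left_mono) auto
    then have "p * (s * (exp 2 - 1) / 2) \<le> p * (s * exp 2 / 2)" using p by (intro mult_left_mono) auto
    also have "\<dots> = r" by (simp add: s_def r_def)
    finally show ?thesis .
  qed
  finally have pr: "p * (exp s - 1) \<le> r" .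
  have "p * trexp (pert f u s) + (1 - p) * trexp f \<le> p * (trexp f + (exp s - 1) * E) + (1 - p) * trexp f"
    using trexp_pert_upper[OF f u s(1)] p by (simp add: mult_left_mono E_def)
  also have "\<dots> = trexp f + p * (exp s - 1) * E" by (simp add: algebra_simps)
  also have "\<dots> \<le> trexp f + r * E" using pr E by (simp add: mult_right_mono)
  also have "\<dots> \<le> trexp (pert f u r)" using trexp_pert_lower[OF f u r] by (simp add: E_def)
  finally show ?thesis using eq[of "2 / M"] eq[of "p * exp 2 / M"] s(1) r unfolding s_def r_def by simp
qed

lemma psd_add_sum_rank1:
  assumes "psd f" "finite A" "\<And>i. i \<in> A \<Longrightarrow> 0 \<le> c i"
  shows "psd (\<lambda>y. f y + (\<Sum>i\<in>A. c i *\<^sub>R rank1 (g i) y))"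
  using assms(2,3)
proof (induction A rule: finite_induct)
  case empty
  then show ?case using assms(1) by simp
next
  case (insert a A)
  have "psd (\<lambda>y. (f y + (\<Sum>i\<in>A. c i *\<^sub>R rank1 (g i) y)) + c a *\<^sub>R rank1 (g a) y)"
    using insert by (intro psd_add_rank1) auto
  then show ?case using insert by (simp add: add_ac)
qed

text \<open>Random summands are exchanged for deterministic ones one at a time. The induction keeps
  \<open>f\<close> arbitrary, since it absorbs the summand of the new element.\<close>

lemma PE_trexp_le:
  assumes "finite A" and f: "psd f" and M: "0 < M"
    and "\<And>i. i \<in> A \<Longrightarrow> (norm (g i))\<^sup>2 \<le> M"
    and "\<And>i. i \<in> A \<Longrightarrow> 0 \<le> p i" "\<And>i. i \<in> A \<Longrightarrow> p i \<le> 1"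
  shows "PE p A (\<lambda>I. trexp (\<lambda>y. f y + (\<Sum>i\<in>I. (2 / M) *\<^sub>R rank1 (g i) y)))
    \<le> trexp (\<lambda>y. f y + (\<Sum>i\<in>A. (p i * exp 2 / M) *\<^sub>R rank1 (g i) y))"
  using assms(1,2,4-)
proof (induction A arbitrary: f rule: finite_induct)
  case (insert a A)
  let ?S = "\<lambda>y. \<Sum>i\<in>A. (p i * exp 2 / M) *\<^sub>R rank1 (g i) y"
  let ?f = "\<lambda>y. f y + (2 / M) *\<^sub>R rank1 (g a) y"
  let ?h = "\<lambda>y. f y + ?S y"
  have pa: "0 \<le> p a" "0 \<le> 1 - p a" using insert.prems by auto
  have psdf: "psd ?f" using M insert.prems by (intro psd_add_rank1) auto
  have psdh: "psd ?h" using M insert by (intro psd_add_sum_rank1) auto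
  have eq: "PE p A (\<lambda>I. trexp (\<lambda>y. f y + (\<Sum>i\<in>insert a I. (2 / M) *\<^sub>R rank1 (g i) y)))
      = PE p A (\<lambda>I. trexp (\<lambda>y. ?f y + (\<Sum>i\<in>I. (2 / M) *\<^sub>R rank1 (g i) y)))"
  proof (intro PE_cong arg_cong[where f = trexp] ext)
    fix I y assume "I \<subseteq> A"
    then have "finite I" "a \<notin> I" using insert finite_subset by auto
    then show "f y + (\<Sum>i\<in>insert a I. (2 / M) *\<^sub>R rank1 (g i) y)
        = ?f y + (\<Sum>i\<in>I. (2 / M) *\<^sub>R rank1 (g i) y)" by simp
  qed
  have "PE p (insert a A) (\<lambda>I. trexp (\<lambda>y. f y + (\<Sum>i\<in>I. (2 / M) *\<^sub>R rank1 (g i) y)))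
    \<le> p a * trexp (\<lambda>y. ?f y + ?S y) + (1 - p a) * trexp ?h"
    unfolding PE_insert[OF insert(1,2)] eq
    using insert.IH[OF psdf] insert.IH[OF insert.prems(1)] insert.prems pa
    by (intro add_mono mult_left_mono) auto
  also have "(\<lambda>y. ?f y + ?S y) = (\<lambda>y. ?h y + (2 / M) *\<^sub>R rank1 (g a) y)" by (simp add: add_ac)
  also have "p a * trexp (\<lambda>y. ?h y + (2 / M) *\<^sub>R rank1 (g a) y) + (1 - p a) * trexp ?h
      \<le> trexp (\<lambda>y. ?h y + (p a * exp 2 / M) *\<^sub>R rank1 (g a) y)"
    using insert.prems M by (intro trexp_bernoulli_step psdh) auto
  also have "(\<lambda>y. ?h y + (p a * exp 2 / M) *\<^sub>R rank1 (g a) y)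
     = (\<lambda>y. f y + (\<Sum>i\<in>insert a A. (p i * exp 2 / M) *\<^sub>R rank1 (g i) y))"
    using insert by (simp add: add_ac)
  finally show ?case .
qed simp

text \<open>Cauchy-Schwarz for \<open>f\<close> with \<open>y = f x\<close> turns a bound on the
  quadratic form into one on the operator norm.\<close>

lemma psd_norm_le:
  assumes f: "psd f" and B: "\<And>x. f x \<bullet> x \<le> B * (norm x)\<^sup>2" and "0 \<le> B"
  shows "norm (f x) \<le> B * norm x"
proof (cases "f x = 0")
  case False
  have "((norm (f x))\<^sup>2)\<^sup>2 \<le> (f x \<bullet> x) * (f (f x) \<bullet> f x)"
    using psd_cauchy_schwarz[OF f, of x "f x"] by (simp add: power2_norm_eq_inner)
  also have "\<dots> \<le> (B * (norm x)\<^sup>2) * (B * (norm (f x))\<^sup>2)"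
    using psd_nonneg[OF f] assms(3) by (intro mult_mono B) simp_all
  finally have "(norm (f x))\<^sup>2 * (norm (f x))\<^sup>2 \<le> (B * norm x)\<^sup>2 * (norm (f x))\<^sup>2"
    by (simp add: power2_eq_square mult_ac)
  then have "(norm (f x))\<^sup>2 \<le> (B * norm x)\<^sup>2"
    by (rule mult_right_le_imp_le) (use False in simp)
  then show ?thesis by (rule power2_le_imp_le) (simp add: assms(3))
qed (use assms(3) in simp)

lemma psd_trexp_nonneg: "psd f \<Longrightarrow> 0 \<le> trexp f"
  unfolding trexp_def
  by (rule suminf_nonneg[OF summable_trexp[OF psd_linear]])
    (auto simp: tr_def intro!: divide_nonneg_nonneg sum_nonneg psd_funpow_nonneg)

text \<open>Eigenvalues are avoided: \<open>f x\<close> is expanded in the basis and Cauchy-Schwarz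
  for \<open>f\<close> is applied to every coordinate.\<close>

lemma psd_inner_le_tr:
  assumes "psd f" "norm x = 1" shows "f x \<bullet> x \<le> tr f"
proof (cases "f x \<bullet> x = 0")
  case True
  then show ?thesis using assms by (simp add: tr_def sum_nonneg psd_nonneg)
next
  case False
  then have pos: "0 < f x \<bullet> x" using psd_nonneg[OF assms(1), of x] by simp
  have "(f x \<bullet> x) * (f x \<bullet> x) \<le> f x \<bullet> f x"
    using Cauchy_Schwarz_ineq[of "f x" x] assms(2) by (simp add: power2_eq_square norm_eq_1)
  also have "\<dots> = (\<Sum>b\<in>Basis. (f x \<bullet> b)\<^sup>2)"
    by (subst euclidean_inner) (simp add: power2_eq_square)
  also have "\<dots> \<le> (\<Sum>b\<in>Basis. (f x \<bullet> x) * (f b \<bullet> b))"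
    by (intro sum_mono psd_cauchy_schwarz assms)
  also have "\<dots> = (f x \<bullet> x) * tr f" by (simp add: tr_def sum_distrib_left)
  finally show ?thesis using pos by simp
qed

text \<open>Supermultiplicative moments give
  \<open>(f x \<bullet> x) ^ n \<le> (f ^^ n) x \<bullet> x\<close>, which the trace dominates; the
  exponential series then sums these bounds.\<close>

lemma psd_trexp_ge:
  assumes f: "psd f" and x: "norm x = 1" shows "exp (f x \<bullet> x) \<le> trexp f"
proof -
  have "(f x \<bullet> x) ^ n \<le> (f ^^ n) x \<bullet> x" for n
  proof (induction n)
    case 0
    then show ?case using x by (simp add: norm_eq_1)
  next
    case (Suc n)
    have "(f x \<bullet> x) ^ Suc n \<le> (f x \<bullet> x) * ((f ^^ n) x \<bullet> x)"
      using Suc psd_nonneg[OF f, of x] by (simp add: mult_left_mono)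
    also have "\<dots> \<le> (f ^^ Suc n) x \<bullet> x"
      using funpow_moment_supermultiplicative[OF f x, of 1 n] by simp
    finally show ?case .
  qed
  then have "(f x \<bullet> x) ^ n \<le> tr (f ^^ n)" for n
    using psd_inner_le_tr[OF psd_funpow[OF f] x] order_trans by blast
  then have "(\<Sum>n. (f x \<bullet> x) ^ n / fact n) \<le> trexp f"
    unfolding trexp_def
    by (intro suminf_le[OF _ summable_power_fact summable_trexp[OF psd_linear[OF f]]])
      (simp add: divide_right_mono)
  then show ?thesis by (simp add: suminf_power_fact)
qed

lemma rank1_inner: "rank1 x y \<bullet> y = (x \<bullet> y)\<^sup>2"
  by (simp add: rank1_def power2_eq_square inner_commute)

text \<open>Markov's inequality for the trace exponential with parameter \<open>2 / M\<close>: on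
  the event it is at least \<open>exp (2 * t / M)\<close>, while its mean is at most
  \<open>trexp G\<close>, where \<open>G\<close> has norm at most \<open>s / M\<close>.\<close>

theorem matrix_chernoff:
  fixes g :: "'i \<Rightarrow> 'a::euclidean_space"
  assumes A: "finite A" and M: "0 < M"
    and gM: "\<And>i. i \<in> A \<Longrightarrow> (norm (g i))\<^sup>2 \<le> M"
    and p: "\<And>i. i \<in> A \<Longrightarrow> 0 \<le> p i" "\<And>i. i \<in> A \<Longrightarrow> p i \<le> 1"
    and s: "\<And>x. exp 2 * (\<Sum>i\<in>A. p i * (g i \<bullet> x)\<^sup>2) \<le> s * (norm x)\<^sup>2" and s0: "0 \<le> s"
  shows "PE p A (\<lambda>I. of_bool (\<exists>x. norm x = 1 \<and> t < (\<Sum>i\<in>I. (g i \<bullet> x)\<^sup>2)))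
    \<le> DIM('a) * exp ((s - 2 * t) / M)"
proof -
  define F where "F I y = 0 + (\<Sum>i\<in>I. (2 / M) *\<^sub>R rank1 (g i) y)" for I :: "'i set" and y
  define G where "G y = 0 + (\<Sum>i\<in>A. (p i * exp 2 / M) *\<^sub>R rank1 (g i) y)" for y
  have psdF: "psd (F I)" if "I \<subseteq> A" for I
    unfolding F_def[abs_def] using M A that finite_subset by (intro psd_add_sum_rank1 psd_zero) auto
  have psdG: "psd G"
    unfolding G_def[abs_def] using M A p by (intro psd_add_sum_rank1 psd_zero) auto
  have G: "G x \<bullet> x \<le> s / M * (norm x)\<^sup>2" for x
  proof -
    have "G x \<bullet> x = exp 2 * (\<Sum>i\<in>A. p i * (g i \<bullet> x)\<^sup>2) / M"
      by (simp add: G_def inner_sum_left rank1_inner sum_distrib_left sum_divide_distrib mult_ac)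
    also have "\<dots> \<le> s * (norm x)\<^sup>2 / M" using s M by (intro divide_right_mono) auto
    finally show ?thesis by simp
  qed
  have "of_bool (\<exists>x. norm x = 1 \<and> t < (\<Sum>i\<in>I. (g i \<bullet> x)\<^sup>2)) \<le> exp (- 2 * t / M) * trexp (F I)"
    if I: "I \<subseteq> A" for I
  proof (cases "\<exists>x. norm x = 1 \<and> t < (\<Sum>i\<in>I. (g i \<bullet> x)\<^sup>2)")
    case True
    then obtain x where x: "norm x = 1" "t < (\<Sum>i\<in>I. (g i \<bullet> x)\<^sup>2)" by blast
    have "F I x \<bullet> x = 2 / M * (\<Sum>i\<in>I. (g i \<bullet> x)\<^sup>2)"
      by (simp add: F_def inner_sum_left rank1_inner sum_distrib_left)
    then have "exp (2 / M * t) \<le> exp (F I x \<bullet> x)" using x M by (simp add: divide_right_mono)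
    also have "\<dots> \<le> trexp (F I)" by (rule psd_trexp_ge[OF psdF[OF I] x(1)])
    finally have "exp (- 2 * t / M) * exp (2 / M * t) \<le> exp (- 2 * t / M) * trexp (F I)"
      by (intro mult_left_mono) auto
    then show ?thesis using True by (simp add: exp_add[symmetric])
  next
    case False
    have "0 \<le> exp (- 2 * t / M) * trexp (F I)" using psd_trexp_nonneg[OF psdF[OF I]] by simp
    with False show ?thesis by (simp only: of_bool_eq if_False)
  qed
  then have "PE p A (\<lambda>I. of_bool (\<exists>x. norm x = 1 \<and> t < (\<Sum>i\<in>I. (g i \<bullet> x)\<^sup>2)))
     \<le> exp (- 2 * t / M) * PE p A (\<lambda>I. trexp (F I))"
    unfolding PE_cmult[symmetric] using p by (intro PE_mono) auto
  also have "\<dots> \<le> exp (- 2 * t / M) * trexp G"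
    unfolding F_def[abs_def] G_def[abs_def]
    by (rule mult_left_mono[OF PE_trexp_le[OF A psd_zero M gM p]]) auto
  also have "\<dots> \<le> exp (- 2 * t / M) * (DIM('a) * exp (s / M))"
    by (rule mult_left_mono[OF trexp_le[OF psd_linear[OF psdG] psd_norm_le[OF psdG G]]])
      (use s0 M in auto)
  also have "\<dots> = DIM('a) * exp ((s - 2 * t) / M)"
    by (simp add: exp_add[symmetric] diff_divide_distrib)
  finally show ?thesis .
qed

section \<open>From Poisson to rejective sampling\<close>

text \<open>Cardinalities are indexed by integers, so that the recursion needs no case \<open>k = 0\<close>.\<close>

definition PE_card :: "('i \<Rightarrow> real) \<Rightarrow> 'i set \<Rightarrow> ('i set \<Rightarrow> real) \<Rightarrow> int \<Rightarrow> real" where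
  "PE_card p A f k = PE p A (\<lambda>I. if int (card I) = k then f I else 0)"

lemma PE_card_empty: "PE_card p {} f k = (if k = 0 then f {} else 0)"
  by (simp add: PE_card_def)

lemma PE_card_insert:
  assumes "finite A" "a \<notin> A"
  shows "PE_card p (insert a A) f k
    = p a * PE_card p A (\<lambda>I. f (insert a I)) (k - 1) + (1 - p a) * PE_card p A f k"
proof -
  have "int (card (insert a I)) = k \<longleftrightarrow> int (card I) = k - 1" if "I \<subseteq> A" for I
  proof -
    have "finite I" "a \<notin> I" using assms that finite_subset by auto
    then show ?thesis by auto
  qed
  then have "PE p A (\<lambda>I. if int (card (insert a I)) = k then f (insert a I) else 0)
     = PE_card p A (\<lambda>I. f (insert a I)) (k - 1)"
    unfolding PE_card_def by (intro PE_cong) simp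
  then show ?thesis unfolding PE_card_def[of p "insert a A"] PE_insert[OF assms] PE_card_def[of p A f] by simp
qed

lemma PE_card_mono:
  assumes "\<And>i. i \<in> A \<Longrightarrow> 0 \<le> p i" "\<And>i. i \<in> A \<Longrightarrow> p i \<le> 1" "\<And>I. I \<subseteq> A \<Longrightarrow> f I \<le> g I"
  shows "PE_card p A f k \<le> PE_card p A g k"
  unfolding PE_card_def using assms by (intro PE_mono) auto

lemma PE_card_nonneg:
  assumes "\<And>i. i \<in> A \<Longrightarrow> 0 \<le> p i" "\<And>i. i \<in> A \<Longrightarrow> p i \<le> 1" "\<And>I. I \<subseteq> A \<Longrightarrow> 0 \<le> f I"
  shows "0 \<le> PE_card p A f k"
  unfolding PE_card_def using assms by (intro PE_nonneg) auto

abbreviation "card_mass p A \<equiv> PE_card p A (\<lambda>_. 1)"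

text \<open>Adjoining an element convolves the law with a two-point law. Both sides expand into four
  products, compared one by one; the induction needs the inequality for all
  \<open>i \<le> j\<close>, not only for neighbours.\<close>

lemma card_mass_log_concave:
  assumes "finite A" "\<And>i. i \<in> A \<Longrightarrow> 0 \<le> p i" "\<And>i. i \<in> A \<Longrightarrow> p i \<le> 1" "i \<le> j"
  shows "card_mass p A i * card_mass p A (j + 1) \<le> card_mass p A (i + 1) * card_mass p A j"
  using assms
proof (induction A arbitrary: i j rule: finite_induct)
  case empty
  then show ?case by (simp add: PE_card_empty)
next
  case (insert a A)
  let ?q = "card_mass p A" and ?x = "p a" and ?y = "1 - p a"
  have x: "0 \<le> ?x" "0 \<le> ?y" using insert.prems by auto
  have lc: "?q i * ?q (j + 1) \<le> ?q (i + 1) * ?q j" if "i \<le> j" for i j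
    using insert.IH[OF _ _ that] insert.prems by auto
  have 1: "?q (i - 1) * ?q j \<le> ?q i * ?q (j - 1)" using lc[of "i - 1" "j - 1"] insert.prems by simp
  \<comment> \<open>For \<open>i = j\<close> both sides agree; otherwise two uses of the induction
    hypothesis pass through \<open>?q i * ?q j\<close>.\<close>
  have 2: "?q (i - 1) * ?q (j + 1) \<le> ?q (i + 1) * ?q (j - 1)"
  proof (cases "i = j")
    case False
    have "?q (i - 1) * ?q (j + 1) \<le> ?q i * ?q j" using lc[of "i - 1" j] insert.prems by simp
    also have "\<dots> \<le> ?q (i + 1) * ?q (j - 1)" using lc[of i "j - 1"] insert.prems False by simp
    finally show ?thesis .
  qed simp
  have "card_mass p (insert a A) i * card_mass p (insert a A) (j + 1)
     = ?x * ?x * (?q (i - 1) * ?q j) + ?x * ?y * (?q (i - 1) * ?q (j + 1))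
       + ?x * ?y * (?q i * ?q j) + ?y * ?y * (?q i * ?q (j + 1))"
    unfolding PE_card_insert[OF insert(1,2)] by (simp add: ring_distribs mult_ac)
  also have "\<dots> \<le> ?x * ?x * (?q i * ?q (j - 1)) + ?x * ?y * (?q (i + 1) * ?q (j - 1))
       + ?x * ?y * (?q i * ?q j) + ?y * ?y * (?q (i + 1) * ?q j)"
    by (intro add_mono mult_left_mono[OF 1] mult_left_mono[OF 2] mult_left_mono[OF lc] order_refl
        mult_nonneg_nonneg x insert.prems)
  also have "\<dots> = card_mass p (insert a A) (i + 1) * card_mass p (insert a A) j"
    unfolding PE_card_insert[OF insert(1,2)] by (simp add: ring_distribs mult_ac)
  finally show ?case .
qed

text \<open>The cross term in the induction for \<open>PE_card_ratio_mono\<close>: \<open>F0\<close>, \<open>F1\<close> and \<open>G0\<close>, \<open>G1\<close> belong to \<open>f\<close>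
  without and with the new element, at neighbouring cardinalities with masses \<open>a\<close>, \<open>b\<close>, \<open>c\<close>. The
  bounds \<open>C\<close> only serve to make the numerators vanish together with the masses.\<close>

lemma increasing_ratio_step:
  fixes a b c F0 F1 G0 G1 C :: real
  assumes nn: "0 \<le> a" "0 \<le> b" "0 \<le> c" "0 \<le> F0" "0 \<le> F1" "0 \<le> G0" "0 \<le> G1"
    and G: "G0 * b \<le> G1 * a" and F: "F0 * c \<le> F1 * b" and FG: "F0 \<le> G1" and lc: "a * c \<le> b * b"
    and C: "G0 \<le> C * a" "G1 \<le> C * b"
  shows "G0 * c + F0 * b \<le> G1 * b + F1 * a"
proof (cases "b = 0")
  case True
  have "a * c = 0" using True lc mult_nonneg_nonneg[OF nn(1,3)] by simp
  moreover have "F0 = 0" "G1 = 0" using True C(2) FG nn by auto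
  moreover have "a = 0 \<Longrightarrow> G0 = 0" using C nn by auto
  ultimately have "G0 * c = 0" "F0 * b = 0" by auto
  moreover have "0 \<le> F1 * a" using nn by simp
  ultimately show ?thesis using True by auto
next
  case False
  then have b: "0 < b" using nn by simp
  \<comment> \<open>The sum of this inequality and the next two is \<open>b\<close> times the claim;
    the terms containing \<open>a * c\<close> cancel.\<close>
  have "0 \<le> (G1 - F0) * (b * b - a * c)" using FG lc by simp
  moreover have "(G0 * b) * c \<le> (G1 * a) * c" "(F0 * c) * a \<le> (F1 * b) * a"
    using G F nn by (auto intro: mult_right_mono)
  ultimately have "b * (G0 * c + F0 * b) \<le> b * (G1 * b + F1 * a)" by (simp add: algebra_simps)
  then show ?thesis using b by simp
qed

text \<open>The products stand for conditional means given the cardinality, whose masses may vanish.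
  On expanding over the new element \<open>a\<close>, the pure terms are the induction hypotheses
  with and without \<open>a\<close>, and the mixed one is
  \<open>increasing_ratio_step\<close>.\<close>

lemma PE_card_ratio_mono:
  assumes "finite A" "\<And>i. i \<in> A \<Longrightarrow> 0 \<le> p i" "\<And>i. i \<in> A \<Longrightarrow> p i \<le> 1"
    and "\<And>I. I \<subseteq> A \<Longrightarrow> 0 \<le> f I" "\<And>I J. I \<subseteq> J \<Longrightarrow> J \<subseteq> A \<Longrightarrow> f I \<le> f J"
  shows "PE_card p A f k * card_mass p A (k + 1) \<le> PE_card p A f (k + 1) * card_mass p A k"
  using assms
proof (induction A arbitrary: f k rule: finite_induct)
  case empty
  then show ?case by (simp add: PE_card_empty)
next
  case (insert a A)
  let ?q = "card_mass p A" and ?x = "p a" and ?y = "1 - p a"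
  let ?G = "PE_card p A (\<lambda>I. f (insert a I))" and ?F = "PE_card p A f"
  have p: "\<And>i. i \<in> A \<Longrightarrow> 0 \<le> p i" "\<And>i. i \<in> A \<Longrightarrow> p i \<le> 1" using insert.prems by auto
  have x: "0 \<le> ?x" "0 \<le> ?y" using insert.prems by auto
  have fnn: "0 \<le> f I" "0 \<le> f (insert a I)" if "I \<subseteq> A" for I using insert.prems(3)[of I] insert.prems(3)[of "insert a I"] that by auto
  have F: "?F k * ?q (k + 1) \<le> ?F (k + 1) * ?q k" for k
    using insert.prems(4) by (intro insert.IH p fnn) auto
  have G: "?G k * ?q (k + 1) \<le> ?G (k + 1) * ?q k" for k
    using insert.prems(4) by (intro insert.IH p fnn insert.prems(4)) auto
  have FG: "?F k \<le> ?G k"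
    by (intro PE_card_mono p insert.prems(4)) auto
  have C: "?G k \<le> f (insert a A) * ?q k" for k
  proof -
    have "?G k \<le> PE_card p A (\<lambda>I. f (insert a A)) k"
      using insert.prems(4) by (intro PE_card_mono p) (auto intro!: insert.prems(4))
    also have "\<dots> = f (insert a A) * ?q k"
      unfolding PE_card_def PE_cmult[symmetric] by (intro PE_cong) simp
    finally show ?thesis .
  qed
  have qnn: "0 \<le> ?q k" for k by (intro PE_card_nonneg p) auto
  have nn: "0 \<le> ?F k" "0 \<le> ?G k" for k using fnn by (auto intro!: PE_card_nonneg p)
  have mid: "?G (k - 1) * ?q (k + 1) + ?F k * ?q k \<le> ?G k * ?q k + ?F (k + 1) * ?q (k - 1)"
  proof (rule increasing_ratio_step[where C = "f (insert a A)"])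
    show "?G (k - 1) * ?q k \<le> ?G k * ?q (k - 1)" using G[of "k - 1"] by simp
    show "?q (k - 1) * ?q (k + 1) \<le> ?q k * ?q k"
      using card_mass_log_concave[where A = A and p = p and i = "k - 1" and j = k, OF insert(1) p] by simp
  qed (use F FG C qnn nn in auto)
  have "PE_card p (insert a A) f k * card_mass p (insert a A) (k + 1)
     = ?x * ?x * (?G (k - 1) * ?q k) + ?x * ?y * (?G (k - 1) * ?q (k + 1) + ?F k * ?q k)
       + ?y * ?y * (?F k * ?q (k + 1))"
    unfolding PE_card_insert[OF insert(1,2)] by (simp add: ring_distribs mult_ac)
  also have "\<dots> \<le> ?x * ?x * (?G k * ?q (k - 1)) + ?x * ?y * (?G k * ?q k + ?F (k + 1) * ?q (k - 1))
       + ?y * ?y * (?F (k + 1) * ?q k)"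
    using G[of "k - 1"]
    by (intro add_mono mult_left_mono[OF mid] mult_left_mono[OF F] mult_left_mono x mult_nonneg_nonneg) simp_all
  also have "\<dots> = PE_card p (insert a A) f (k + 1) * card_mass p (insert a A) k"
    unfolding PE_card_insert[OF insert(1,2)] by (simp add: ring_distribs mult_ac)
  finally show ?case .
qed

text \<open>Chaining the ratios upwards compares the layer \<open>S\<close> with every later one;
  summing these layers and discarding those below \<open>S\<close> gives the bound.\<close>

lemma PE_card_mult_tail_le:
  assumes A: "finite A" and p: "\<And>i. i \<in> A \<Longrightarrow> 0 \<le> p i" "\<And>i. i \<in> A \<Longrightarrow> p i \<le> 1"
    and f: "\<And>I. I \<subseteq> A \<Longrightarrow> 0 \<le> f I" "\<And>I J. I \<subseteq> J \<Longrightarrow> J \<subseteq> A \<Longrightarrow> f I \<le> f J"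
  shows "PE_card p A f (int S) * PE p A (\<lambda>I. of_bool (S \<le> card I)) \<le> card_mass p A (int S) * PE p A f"
proof -
  let ?q = "card_mass p A" and ?F = "PE_card p A f" and ?S = "int S"
  have qnn: "0 \<le> ?q k" for k by (intro PE_card_nonneg p) auto
  have Fnn: "0 \<le> ?F k" for k using f by (auto intro!: PE_card_nonneg p)
  have C: "?F k \<le> f A * ?q k" for k
  proof -
    have "?F k \<le> PE_card p A (\<lambda>I. f A) k" using f by (intro PE_card_mono p) auto
    also have "\<dots> = f A * ?q k"
      unfolding PE_card_def PE_cmult[symmetric] by (intro PE_cong) simp
    finally show ?thesis .
  qed
  have ratio: "?F ?S * ?q k \<le> ?F k * ?q ?S" if "?S \<le> k" for k
    using that
  proof (induction k rule: int_ge_induct)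
    case (step k)
    show ?case
    proof (cases "?q k = 0")
      \<comment> \<open>If the mass vanishes at \<open>k\<close>, log-concavity leaves
        \<open>?q ?S = 0\<close> or \<open>?q (k + 1) = 0\<close>, and either makes the left side
        zero.\<close>
      case True
      then have "?q ?S * ?q (k + 1) = 0"
        using card_mass_log_concave[where A = A and p = p and i = ?S and j = k, OF A p] step.hyps mult_nonneg_nonneg[OF qnn[of ?S] qnn[of "k + 1"]] by simp
      moreover have "?q ?S = 0 \<Longrightarrow> ?F ?S = 0" using C[of ?S] Fnn[of ?S] by simp
      ultimately show ?thesis using Fnn qnn by auto
    next
      case False
      then have qk: "0 < ?q k" using qnn[of k] by simp
      have "?q k * (?F ?S * ?q (k + 1)) = (?F ?S * ?q k) * ?q (k + 1)" by simp
      also have "\<dots> \<le> (?F k * ?q ?S) * ?q (k + 1)" using step.IH qnn by (intro mult_right_mono)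
      also have "\<dots> = (?F k * ?q (k + 1)) * ?q ?S" by simp
      also have "\<dots> \<le> (?F (k + 1) * ?q k) * ?q ?S"
        by (intro mult_right_mono PE_card_ratio_mono A p f qnn)
      finally have "?q k * (?F ?S * ?q (k + 1)) \<le> ?q k * (?F (k + 1) * ?q ?S)" by (simp add: mult_ac)
      then show ?thesis using qk by simp
    qed
  qed simp
  have layers: "PE p A (\<lambda>I. if S \<le> card I then g I else 0) = (\<Sum>k\<in>{S..card A}. PE_card p A g (int k))" for g
  proof -
    have "(if S \<le> card I then g I else 0) = (\<Sum>k\<in>{S..card A}. if int (card I) = int k then g I else 0)"
      if "I \<subseteq> A" for I
      using card_mono[OF A that] by (simp add: sum.delta' del: of_nat_eq_iff) (simp add: sum.delta')
    then show ?thesis unfolding PE_card_def PE_sum[symmetric] by (intro PE_cong) auto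
  qed
  have "?F ?S * PE p A (\<lambda>I. of_bool (S \<le> card I)) = (\<Sum>k\<in>{S..card A}. ?F ?S * ?q (int k))"
    using layers[of "\<lambda>_. 1"] by (simp add: of_bool_def sum_distrib_left)
  also have "\<dots> \<le> (\<Sum>k\<in>{S..card A}. ?F (int k) * ?q ?S)" by (intro sum_mono ratio) simp
  also have "\<dots> = ?q ?S * PE p A (\<lambda>I. if S \<le> card I then f I else 0)"
    by (simp add: layers sum_distrib_left mult.commute)
  also have "\<dots> \<le> ?q ?S * PE p A f" using f by (intro mult_left_mono PE_mono p qnn) auto
  finally show ?thesis .
qed

section \<open>Moments of the cardinality and its upper tail at the mean\<close>

definition dev :: "('i \<Rightarrow> real) \<Rightarrow> 'i set \<Rightarrow> 'i set \<Rightarrow> real" where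
  "dev p A I = real (card I) - sum p A"

lemma PE_dev_insert:
  assumes "finite A" "a \<notin> A"
  shows "PE p (insert a A) (\<lambda>I. h (dev p (insert a A) I))
   = PE p A (\<lambda>I. p a * h (dev p A I + (1 - p a)) + (1 - p a) * h (dev p A I - p a))"
proof -
  have "dev p (insert a A) (insert a I) = dev p A I + (1 - p a)" if "I \<subseteq> A" for I
  proof -
    have "finite I" "a \<notin> I" using assms that finite_subset by auto
    then show ?thesis using assms by (simp add: dev_def)
  qed
  then have "PE p A (\<lambda>I. h (dev p (insert a A) (insert a I))) = PE p A (\<lambda>I. h (dev p A I + (1 - p a)))"
    by (intro PE_cong) simp
  moreover have "dev p (insert a A) I = dev p A I - p a" for I using assms by (simp add: dev_def)
  ultimately show ?thesis by (simp add: PE_insert[OF assms] PE_add PE_cmult)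
qed

lemma PE_dev: "finite A \<Longrightarrow> PE p A (dev p A) = 0"
proof (induction A rule: finite_induct)
  case (insert a A)
  have "PE p (insert a A) (dev p (insert a A))
     = PE p A (\<lambda>I. p a * (dev p A I + (1 - p a)) + (1 - p a) * (dev p A I - p a))"
    by (rule PE_dev_insert[OF insert(1,2)])
  also have "\<dots> = PE p A (dev p A)" by (intro PE_cong) (simp add: algebra_simps)
  finally show ?case using insert by simp
qed (simp add: dev_def)

lemma PE_dev_sq: "finite A \<Longrightarrow> PE p A (\<lambda>I. (dev p A I)\<^sup>2) = (\<Sum>i\<in>A. p i * (1 - p i))"
proof (induction A rule: finite_induct)
  case (insert a A)
  have "PE p (insert a A) (\<lambda>I. (dev p (insert a A) I)\<^sup>2)
     = PE p A (\<lambda>I. p a * (dev p A I + (1 - p a))\<^sup>2 + (1 - p a) * (dev p A I - p a)\<^sup>2)"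
    by (rule PE_dev_insert[OF insert(1,2)])
  also have "\<dots> = PE p A (\<lambda>I. (dev p A I)\<^sup>2 + p a * (1 - p a))"
    by (intro PE_cong) (simp add: power2_eq_square algebra_simps)
  also have "\<dots> = (\<Sum>i\<in>insert a A. p i * (1 - p i))"
    using insert by (simp add: PE_add PE_const)
  finally show ?case .
qed (simp add: dev_def)

text \<open>An element of variance \<open>w\<close> adds \<open>6 * w * ?v + c4\<close>: the term
  with \<open>c3\<close> drops out because \<open>dev\<close> has mean zero. Since
  \<open>c4 \<le> w\<close>, the increase of the right side covers this.\<close>

lemma PE_dev_fourth:
  assumes "finite A" "\<And>i. i \<in> A \<Longrightarrow> 0 \<le> p i" "\<And>i. i \<in> A \<Longrightarrow> p i \<le> 1"
  shows "PE p A (\<lambda>I. (dev p A I) ^ 4) \<le> 3 * (\<Sum>i\<in>A. p i * (1 - p i))\<^sup>2 + (\<Sum>i\<in>A. p i * (1 - p i))"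
  using assms
proof (induction A rule: finite_induct)
  case (insert a A)
  let ?x = "p a" and ?v = "\<Sum>i\<in>A. p i * (1 - p i)"
  define w where "w = ?x * (1 - ?x)"
  define c3 where "c3 = 4 * (?x * (1 - ?x) ^ 3 - (1 - ?x) * ?x ^ 3)"
  define c4 where "c4 = ?x * (1 - ?x) ^ 4 + (1 - ?x) * ?x ^ 4"
  have x: "0 \<le> ?x" "?x \<le> 1" using insert.prems by auto
  have w: "0 \<le> w" using x by (simp add: w_def)
  have c4: "c4 \<le> w"
  proof -
    have "(1 - ?x) ^ 3 \<le> (1 - ?x) ^ 1" "?x ^ 3 \<le> ?x ^ 1" using x by (intro power_decreasing; simp)+
    then have "(1 - ?x) ^ 3 + ?x ^ 3 \<le> 1" by simp
    then have "w * ((1 - ?x) ^ 3 + ?x ^ 3) \<le> w * 1" using w by (intro mult_left_mono)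
    moreover have "c4 = w * ((1 - ?x) ^ 3 + ?x ^ 3)"
      by (simp add: c4_def w_def power3_eq_cube power4_eq_xxxx algebra_simps)
    ultimately show ?thesis by simp
  qed
  have "PE p (insert a A) (\<lambda>I. (dev p (insert a A) I) ^ 4)
     = PE p A (\<lambda>I. ?x * (dev p A I + (1 - ?x)) ^ 4 + (1 - ?x) * (dev p A I - ?x) ^ 4)"
    by (rule PE_dev_insert[OF insert(1,2)])
  also have "\<dots> = PE p A (\<lambda>I. ((dev p A I) ^ 4 + (6 * w) * (dev p A I)\<^sup>2) + (c3 * dev p A I + c4))"
    by (intro PE_cong)
      (simp add: w_def c3_def c4_def power2_eq_square power3_eq_cube power4_eq_xxxx algebra_simps)
  also have "\<dots> = PE p A (\<lambda>I. (dev p A I) ^ 4) + 6 * w * ?v + c4"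
    using insert by (simp add: PE_add PE_const PE_cmult PE_dev PE_dev_sq)
  also have "\<dots> \<le> (3 * ?v\<^sup>2 + ?v) + 6 * w * ?v + w"
    using insert c4 by (intro add_mono insert.IH) auto
  also have "\<dots> \<le> 3 * (?v + w)\<^sup>2 + (?v + w)" by (simp add: power2_eq_square algebra_simps)
  finally show ?case using insert by (simp add: w_def add.commute)
qed (simp add: dev_def)

text \<open>The double root at -2 keeps the quartic nonpositive for \<open>y < 0\<close>; for
  \<open>y \<ge> 0\<close> a sum of squares keeps it below 80. Its average bounds a probability from
  below by moments.\<close>

lemma quartic_minorant: "16 * y + 12 * y\<^sup>2 - y ^ 4 \<le> 80 * of_bool (0 \<le> y)" for y :: real
proof (cases "0 \<le> y")
  case True
  have "80 - (16 * y + 12 * y\<^sup>2 - y ^ 4) = (y\<^sup>2 - 8)\<^sup>2 + 4 * (y - 2)\<^sup>2"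
    by (simp add: power2_eq_square power4_eq_xxxx algebra_simps)
  also have "\<dots> \<ge> 0" by simp
  finally show ?thesis using True by simp
next
  case False
  have "16 * y + 12 * y\<^sup>2 - y ^ 4 = y * ((y + 2)\<^sup>2 * (4 - y))"
    by (simp add: power2_eq_square power4_eq_xxxx algebra_simps)
  also have "\<dots> \<le> 0" using False by (intro mult_nonpos_nonneg mult_nonneg_nonneg) auto
  finally show ?thesis using False by simp
qed

text \<open>For variance \<open>v > 1\<close> the quartic is averaged at
  \<open>dev / sqrt v\<close>: its mean is at least \<open>12 - 3 - 1 / v \<ge> 8\<close>, and 8 /
  80 is the constant. For \<open>v \<le> 1\<close> a parabola suffices.\<close>

lemma PE_card_ge_mean:
  assumes A: "finite A" and p: "\<And>i. i \<in> A \<Longrightarrow> 0 \<le> p i" "\<And>i. i \<in> A \<Longrightarrow> p i \<le> 1"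
    and S: "sum p A = real S"
  shows "1 / 10 \<le> PE p A (\<lambda>I. of_bool (S \<le> card I))"
proof -
  define v where "v = (\<Sum>i\<in>A. p i * (1 - p i))"
  have v0: "0 \<le> v" unfolding v_def using p by (intro sum_nonneg) auto
  have ev: "S \<le> card I \<longleftrightarrow> 0 \<le> dev p A I" for I by (simp add: dev_def S)
  show ?thesis
  proof (cases "v \<le> 1")
    case True
    \<comment> \<open>Cantelli's inequality, using that \<open>dev\<close> is an integer and hence at most \<open>-1\<close> when negative.\<close>
    have pt: "(1 - (v / (1 + v))\<^sup>2) + ((2 * v / (1 + v)\<^sup>2) * dev p A I + (- 1 / (1 + v)\<^sup>2) * (dev p A I)\<^sup>2)
        \<le> of_bool (S \<le> card I)" (is "?l I \<le> _") for I
    proof -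
      \<comment> \<open>The minorant is the parabola in \<open>dev\<close> with maximum 1 at
        \<open>v\<close> and a zero at -1.\<close>
      have l: "?l I = 1 - ((dev p A I - v) / (1 + v))\<^sup>2"
        by (simp add: power_divide power2_diff diff_divide_distrib) (simp add: power2_eq_square)
      show ?thesis
      proof (cases "S \<le> card I")
        case False
        then have "1 + v \<le> - (dev p A I - v)" by (simp add: dev_def S)
        then have "(1 + v)\<^sup>2 \<le> (- (dev p A I - v))\<^sup>2" using v0 by (intro power_mono) auto
        then have "1 \<le> ((dev p A I - v) / (1 + v))\<^sup>2"
          using v0 by (simp add: power_divide power2_commute[of v])
        then show ?thesis using False l by simp
      qed (use l in simp)
    qed
    have "1 / w = (1 - ((w - 1) / w)\<^sup>2) - (w - 1) / w\<^sup>2" if "0 < w" for w :: real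
      using that by (simp add: field_simps power2_eq_square)
    from this[of "1 + v"] have "1 / (1 + v) = (1 - (v / (1 + v))\<^sup>2) - v / (1 + v)\<^sup>2"
      using v0 by simp
    also have "\<dots> = PE p A ?l"
      unfolding PE_add PE_cmult PE_const[OF A] PE_dev[OF A] PE_dev_sq[OF A] v_def[symmetric] by simp
    also have "\<dots> \<le> PE p A (\<lambda>I. of_bool (S \<le> card I))" by (intro PE_mono p pt)
    finally have "1 / (1 + v) \<le> PE p A (\<lambda>I. of_bool (S \<le> card I))" .
    moreover have "1 / 10 \<le> 1 / (1 + v)" using True v0 by (simp add: field_simps)
    ultimately show ?thesis by linarith
  next
    case False
    define s where "s = sqrt v"
    have s: "0 < s" "s\<^sup>2 = v" "s ^ 4 = v\<^sup>2"
      using False v0 by (auto simp: s_def) (simp add: power4_eq_xxxx power2_eq_square)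
    have pt: "(16 / s) * dev p A I + (12 / v) * (dev p A I)\<^sup>2 + (- 1 / v\<^sup>2) * (dev p A I) ^ 4
        \<le> 80 * of_bool (S \<le> card I)" (is "?l I \<le> _") for I
    proof -
      have "0 \<le> dev p A I / s \<longleftrightarrow> 0 \<le> dev p A I" using s(1) by (simp add: zero_le_divide_iff)
      then show ?thesis using quartic_minorant[of "dev p A I / s"] by (simp only: power_divide s ev) simp
    qed
    have "8 \<le> 12 - (3 * v\<^sup>2 + v) / v\<^sup>2"
      using False by (simp add: field_simps power2_eq_square)
    also have "\<dots> \<le> 12 - PE p A (\<lambda>I. (dev p A I) ^ 4) / v\<^sup>2"
      using PE_dev_fourth[OF A p] by (simp add: v_def divide_right_mono)
    also have "\<dots> = PE p A ?l"
      unfolding PE_add PE_cmult using A False by (simp add: PE_dev PE_dev_sq v_def[symmetric])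
    also have "\<dots> \<le> PE p A (\<lambda>I. 80 * of_bool (S \<le> card I))" by (intro PE_mono p pt)
    finally show ?thesis by (simp add: PE_cmult)
  qed
qed

lemma PE_card_le_PE:
  assumes A: "finite A" and p: "\<And>i. i \<in> A \<Longrightarrow> 0 \<le> p i" "\<And>i. i \<in> A \<Longrightarrow> p i \<le> 1"
    and S: "sum p A = real S"
    and f: "\<And>I. I \<subseteq> A \<Longrightarrow> 0 \<le> f I" "\<And>I J. I \<subseteq> J \<Longrightarrow> J \<subseteq> A \<Longrightarrow> f I \<le> f J"
  shows "PE_card p A f (int S) \<le> 10 * (card_mass p A (int S) * PE p A f)"
proof -
  have "0 \<le> PE_card p A f (int S)" using f by (auto intro!: PE_card_nonneg p)
  then have "PE_card p A f (int S) * (1 / 10) \<le> PE_card p A f (int S) * PE p A (\<lambda>I. of_bool (S \<le> card I))"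
    by (intro mult_left_mono PE_card_ge_mean A p S)
  also have "\<dots> \<le> card_mass p A (int S) * PE p A f" by (rule PE_card_mult_tail_le[OF A p f])
  finally show ?thesis by simp
qed

section \<open>Norms of random submatrices of a hollow symmetric matrix\<close>

text \<open>Submatrices are modelled by zeroing coordinates, so that all index sets share one vector
  space and blocks can be compared directly.\<close>

definition rst :: "'k set \<Rightarrow> real^'k \<Rightarrow> real^'k" where
  "rst I x = (\<chi> i. if i \<in> I then x $ i else 0)"

definition sub_norm :: "real^'k^'k \<Rightarrow> 'k set \<Rightarrow> 'k set \<Rightarrow> real" where
  "sub_norm H I J = onorm (\<lambda>x. rst I (H *v rst J x))"

lemma rst_nth [simp]: "rst I x $ i = (if i \<in> I then x $ i else 0)"
  by (simp add: rst_def)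

lemma linear_rst: "linear (rst I)"
  by (rule linearI) (auto simp: vec_eq_iff)

lemma linear_sub: "linear (\<lambda>x. rst I (H *v rst J x))" for H :: "real^'k^'k"
  using linear_compose[OF linear_compose[OF linear_rst[of J] matrix_vector_mul_linear[of H]] linear_rst[of I]]
  by (simp add: o_def)

lemma norm_sq_sum: "(norm x)\<^sup>2 = (\<Sum>i\<in>UNIV. (x $ i)\<^sup>2)" for x :: "real^'k"
  by (simp only: power2_norm_eq_inner inner_vec_def) (simp add: power2_eq_square)

lemma rst_inner: "rst I x \<bullet> y = x \<bullet> rst I y"
  by (simp add: inner_vec_def if_distrib cong: if_cong) (rule sum.cong; simp)

lemma norm_rst_sq: "(norm (rst I x))\<^sup>2 = (\<Sum>i\<in>I. (x $ i)\<^sup>2)"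
  unfolding norm_sq_sum by (simp add: if_distrib[of "\<lambda>u. u\<^sup>2"] sum.If_cases cong: if_cong)

lemma norm_rst_le: "norm (rst I x) \<le> norm x"
proof (rule power2_le_imp_le)
  show "(norm (rst I x))\<^sup>2 \<le> (norm x)\<^sup>2"
    unfolding norm_rst_sq unfolding norm_sq_sum by (intro sum_mono2) auto
qed simp

lemma sub_norm_nonneg: "0 \<le> sub_norm H I J"
  unfolding sub_norm_def by (rule onorm_pos_le) (rule linear_conv_bounded_linear[THEN iffD1, OF linear_sub])

lemma sub_norm_bound: "norm (rst I (H *v rst J x)) \<le> sub_norm H I J * norm x"
  unfolding sub_norm_def by (rule onorm) (rule linear_conv_bounded_linear[THEN iffD1, OF linear_sub])

lemma sub_norm_le: "0 \<le> b \<Longrightarrow> (\<And>x. norm (rst I (H *v rst J x)) \<le> b * norm x) \<Longrightarrow> sub_norm H I J \<le> b"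
  unfolding sub_norm_def by (rule onorm_bound)

lemma sub_norm_gt_witness:
  fixes H :: "real^'k^'k"
  assumes "b < sub_norm H I J" "0 \<le> b"
  obtains x where "norm x = 1" "b < norm (rst I (H *v rst J x))"
proof -
  have "\<exists>x. b * norm x < norm (rst I (H *v rst J x))"
  proof (rule ccontr)
    assume "\<not> ?thesis"
    then have "sub_norm H I J \<le> b" by (intro sub_norm_le assms(2)) (simp add: not_less)
    then show False using assms(1) by simp
  qed
  then obtain x where x: "b * norm x < norm (rst I (H *v rst J x))" by blast
  have "x \<noteq> 0"
  proof
    assume "x = 0"
    then have "rst I (H *v rst J x) = 0" using linear_0[OF linear_sub[of I H J]] by simp
    then show False using x \<open>x = 0\<close> by simp
  qed
  have "rst I (H *v rst J (x /\<^sub>R norm x)) = rst I (H *v rst J x) /\<^sub>R norm x"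
    by (rule linear_scale[OF linear_sub])
  then have "b < norm (rst I (H *v rst J (x /\<^sub>R norm x)))"
    using x \<open>x \<noteq> 0\<close> by (simp add: field_simps)
  then show ?thesis using that[of "x /\<^sub>R norm x"] \<open>x \<noteq> 0\<close> by simp
qed

lemma rst_rst: "rst I (rst J x) = rst (I \<inter> J) x"
  by (simp add: vec_eq_iff)

lemma sub_norm_mono:
  assumes "I \<subseteq> I'" "J \<subseteq> J'" shows "sub_norm H I J \<le> sub_norm H I' J'"
proof (rule sub_norm_le)
  fix x
  have "rst I (H *v rst J x) = rst I (rst I' (H *v rst J' (rst J x)))"
    using assms by (simp add: rst_rst Int_absorb1 Int_absorb2)
  then have "norm (rst I (H *v rst J x)) \<le> norm (rst I' (H *v rst J' (rst J x)))"
    using norm_rst_le by metis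
  also have "\<dots> \<le> sub_norm H I' J' * norm (rst J x)" by (rule sub_norm_bound)
  also have "\<dots> \<le> sub_norm H I' J' * norm x"
    by (intro mult_left_mono norm_rst_le sub_norm_nonneg)
  finally show "norm (rst I (H *v rst J x)) \<le> sub_norm H I' J' * norm x" .
qed (rule sub_norm_nonneg)

lemma symmetric_matrix_inner:
  fixes H :: "real^'k^'k"
  assumes "transpose H = H" shows "(H *v x) \<bullet> y = x \<bullet> (H *v y)"
  using assms by (metis dot_lmul_matrix vector_transpose_matrix)

text \<open>The two blocks are adjoint: \<open>?u \<bullet> ?u\<close> is the pairing of
  \<open>x\<close> with the opposite block applied to \<open>?u\<close>.\<close>

lemma sub_norm_commute:
  assumes "transpose H = H" shows "sub_norm H I J = sub_norm H J I"
proof -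
  have "sub_norm H I J \<le> sub_norm H J I" for I J
  proof (rule sub_norm_le)
    fix x
    let ?u = "rst I (H *v rst J x)"
    have "norm ?u * norm ?u = ?u \<bullet> ?u" by (simp add: norm_eq_sqrt_inner)
    also have "\<dots> = x \<bullet> rst J (H *v rst I ?u)"
      by (simp only: rst_inner[symmetric] symmetric_matrix_inner[OF assms, symmetric])
    also have "\<dots> \<le> norm x * norm (rst J (H *v rst I ?u))" by (rule norm_cauchy_schwarz)
    also have "\<dots> \<le> norm x * (sub_norm H J I * norm ?u)" by (intro mult_left_mono sub_norm_bound) simp
    finally have "norm ?u * norm ?u \<le> (sub_norm H J I * norm x) * norm ?u" by (simp add: mult_ac)
    then show "norm ?u \<le> sub_norm H J I * norm x"
      using sub_norm_nonneg[of H J I] by (cases "?u = 0") auto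
  qed (rule sub_norm_nonneg)
  then show ?thesis by (intro antisym) auto
qed

section \<open>Decoupling by a random bipartition\<close>

lemma PE_half_separated:
  assumes "finite A" "i \<in> A" "j \<in> A" "i \<noteq> j"
  shows "PE (\<lambda>_. 1 / 2) A (\<lambda>B. of_bool ((i \<in> B) \<noteq> (j \<in> B))) = 1 / 2"
proof -
  have A: "A = insert i (A - {i})" and fin: "finite (A - {i})" using assms by auto
  let ?P = "PE (\<lambda>_. 1 / 2) (A - {i})"
  \<comment> \<open>Once the coin of \<open>i\<close> is fixed, separation depends only on the coin
    of \<open>j\<close>, and the two cases give complementary events.\<close>
  have "?P (\<lambda>B. of_bool ((i \<in> insert i B) \<noteq> (j \<in> insert i B))) = ?P (\<lambda>B. of_bool (j \<notin> B))"
    "?P (\<lambda>B. of_bool ((i \<in> B) \<noteq> (j \<in> B))) = ?P (\<lambda>B. of_bool (j \<in> B))"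
    using assms by (auto intro!: PE_cong)
  moreover have "?P (\<lambda>B. of_bool (j \<notin> B)) + ?P (\<lambda>B. of_bool (j \<in> B)) = 1"
  proof -
    have "?P (\<lambda>B. of_bool (j \<notin> B) + of_bool (j \<in> B)) = ?P (\<lambda>_. 1)" by (rule PE_cong) simp
    then show ?thesis by (simp add: PE_add PE_const[OF fin])
  qed
  ultimately show ?thesis
    by (subst A, subst PE_insert[OF fin]) (auto simp: field_simps)
qed

text \<open>\<open>I \<inter> B\<close> and \<open>I - B\<close> use disjoint sets of coins, hence
  behave like parts of two independent samples; enlarging them to the full samples can only raise
  \<open>\<phi>\<close>.\<close>

lemma PE_decouple:
  assumes "finite A" "\<And>i. i \<in> A \<Longrightarrow> 0 \<le> p i" "\<And>i. i \<in> A \<Longrightarrow> p i \<le> 1"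
    and "\<And>I I' J J'. I \<subseteq> I' \<Longrightarrow> J \<subseteq> J' \<Longrightarrow> \<phi> I J \<le> \<phi> I' J'"
  shows "PE p A (\<lambda>I. \<phi> (I \<inter> B) (I - B)) \<le> PE p A (\<lambda>I. PE p A (\<lambda>J. \<phi> I J))"
  using assms
proof (induction A arbitrary: \<phi> rule: finite_induct)
  case (insert a A)
  have p: "\<And>i. i \<in> A \<Longrightarrow> 0 \<le> p i" "\<And>i. i \<in> A \<Longrightarrow> p i \<le> 1" and pa: "0 \<le> p a" "0 \<le> 1 - p a"
    using insert.prems by auto
  have IH: "PE p A (\<lambda>I. \<psi> (I \<inter> B) (I - B)) \<le> PE p A (\<lambda>I. PE p A (\<lambda>J. \<psi> I J))"
    if "\<And>I I' J J'. I \<subseteq> I' \<Longrightarrow> J \<subseteq> J' \<Longrightarrow> \<psi> I J \<le> \<psi> I' J'" for \<psi>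
    by (rule insert.IH[OF p that])
  let ?E = "\<lambda>\<psi>. PE p A (\<lambda>I. PE p A (\<lambda>J. \<psi> I J))"
  have m: "?E \<phi> \<le> ?E (\<lambda>I J. \<phi> I (insert a J))" "?E \<phi> \<le> ?E (\<lambda>I J. \<phi> (insert a I) J)"
    "?E (\<lambda>I J. \<phi> (insert a I) J) \<le> ?E (\<lambda>I J. \<phi> (insert a I) (insert a J))"
    "?E (\<lambda>I J. \<phi> I (insert a J)) \<le> ?E (\<lambda>I J. \<phi> (insert a I) (insert a J))"
    by (intro PE_mono p insert.prems; auto)+
  have rhs: "PE p (insert a A) (\<lambda>I. PE p (insert a A) (\<lambda>J. \<phi> I J))
     = p a * (p a * ?E (\<lambda>I J. \<phi> (insert a I) (insert a J)) + (1 - p a) * ?E (\<lambda>I J. \<phi> (insert a I) J))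
       + (1 - p a) * (p a * ?E (\<lambda>I J. \<phi> I (insert a J)) + (1 - p a) * ?E \<phi>)"
    by (simp only: PE_insert[OF insert(1,2)] PE_add PE_cmult) (simp add: algebra_simps)
  \<comment> \<open>A second, independent coin for \<open>a\<close> is introduced as an average of
    equal terms.\<close>
  have convex: "p a * u + (1 - p a) * u = u" for u by (simp add: algebra_simps)
  have lhs2: "PE p A (\<lambda>I. \<phi> (I \<inter> B) (I - B)) \<le> ?E \<phi>" by (rule IH[OF insert.prems(3)])
  show ?case
  proof (cases "a \<in> B")
    case True
    have "PE p A (\<lambda>I. \<phi> (insert a I \<inter> B) (insert a I - B)) \<le> ?E (\<lambda>I J. \<phi> (insert a I) J)"
    proof -
      have "\<phi> (insert a I) J \<le> \<phi> (insert a I') J'" if "I \<subseteq> I'" "J \<subseteq> J'" for I I' J J'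
        using that by (intro insert.prems(3)) auto
      from IH[of "\<lambda>I J. \<phi> (insert a I) J", OF this] show ?thesis using True by simp
    qed
    then have "PE p (insert a A) (\<lambda>I. \<phi> (I \<inter> B) (I - B))
      \<le> p a * ?E (\<lambda>I J. \<phi> (insert a I) J) + (1 - p a) * ?E \<phi>"
      unfolding PE_insert[OF insert(1,2)] using lhs2 pa by (intro add_mono mult_left_mono)
    also have "\<dots> = p a * (p a * ?E (\<lambda>I J. \<phi> (insert a I) J) + (1 - p a) * ?E (\<lambda>I J. \<phi> (insert a I) J))
       + (1 - p a) * (p a * ?E \<phi> + (1 - p a) * ?E \<phi>)" by (simp only: convex)
    also have "\<dots> \<le> PE p (insert a A) (\<lambda>I. PE p (insert a A) (\<lambda>J. \<phi> I J))"
      unfolding rhs by (intro add_mono mult_left_mono m pa order_refl)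
    finally show ?thesis .
  next
    case False
    have "PE p A (\<lambda>I. \<phi> (insert a I \<inter> B) (insert a I - B)) \<le> ?E (\<lambda>I J. \<phi> I (insert a J))"
    proof -
      have "\<phi> I (insert a J) \<le> \<phi> I' (insert a J')" if "I \<subseteq> I'" "J \<subseteq> J'" for I I' J J'
        using that by (intro insert.prems(3)) auto
      from IH[of "\<lambda>I J. \<phi> I (insert a J)", OF this] show ?thesis
        using False by (simp add: insert_Diff_if)
    qed
    then have "PE p (insert a A) (\<lambda>I. \<phi> (I \<inter> B) (I - B))
      \<le> p a * ?E (\<lambda>I J. \<phi> I (insert a J)) + (1 - p a) * ?E \<phi>"
      unfolding PE_insert[OF insert(1,2)] using lhs2 pa by (intro add_mono mult_left_mono)
    also have "\<dots> = (p a * p a) * ?E (\<lambda>I J. \<phi> I (insert a J)) + p a * ((1 - p a) * ?E (\<lambda>I J. \<phi> I (insert a J)))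
      + (1 - p a) * (p a * ?E \<phi> + (1 - p a) * ?E \<phi>)" by (simp add: algebra_simps)
    also have "\<dots> \<le> (p a * p a) * ?E (\<lambda>I J. \<phi> (insert a I) (insert a J)) + p a * ((1 - p a) * ?E (\<lambda>I J. \<phi> I (insert a J)))
      + (1 - p a) * (p a * ?E (\<lambda>I J. \<phi> (insert a I) J) + (1 - p a) * ?E \<phi>)"
      by (intro add_mono mult_left_mono m pa order_refl mult_nonneg_nonneg)
    also have "\<dots> = PE p (insert a A) (\<lambda>I. PE p (insert a A) (\<lambda>J. \<phi> I J))"
      unfolding rhs by (simp add: algebra_simps)
    finally show ?thesis .
  qed
qed simp

text \<open>A uniformly random \<open>B\<close> separates each pair \<open>i \<noteq> j\<close> with probability \<open>1/2\<close>, and the symmetric matrix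
  consisting of the two off-diagonal blocks has the norm of one of them.\<close>

lemma sub_norm_decouple:
  fixes H :: "real^'k^'k"
  assumes sym: "transpose H = H" and hollow: "\<And>i. H $ i $ i = 0"
  shows "sub_norm H I I \<le> PE (\<lambda>_. 1 / 2) UNIV (\<lambda>B. 2 * sub_norm H (I \<inter> B) (I - B))"
proof -
  let ?E = "PE (\<lambda>_. 1 / 2) (UNIV :: 'k set)"
  define b where "b = ?E (\<lambda>B. 2 * sub_norm H (I \<inter> B) (I - B))"
  have b0: "0 \<le> b" unfolding b_def by (intro PE_nonneg) (auto simp: sub_norm_nonneg)
  have form: "y \<bullet> rst A (H *v rst C x) = (\<Sum>i\<in>UNIV. \<Sum>j\<in>UNIV. of_bool (i \<in> A \<and> j \<in> C) * (H $ i $ j * y $ i * x $ j))"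
    for A C and x y :: "real^'k"
  proof -
    have "y \<bullet> rst A (H *v rst C x) = (\<Sum>i\<in>UNIV. y $ i * (if i \<in> A then (\<Sum>j\<in>UNIV. H $ i $ j * (if j \<in> C then x $ j else 0)) else 0))"
      by (simp add: inner_vec_def matrix_vector_mult_def cong: if_cong)
    also have "\<dots> = (\<Sum>i\<in>UNIV. \<Sum>j\<in>UNIV. of_bool (i \<in> A \<and> j \<in> C) * (H $ i $ j * y $ i * x $ j))"
    proof (rule sum.cong[OF refl])
      fix i
      show "y $ i * (if i \<in> A then (\<Sum>j\<in>UNIV. H $ i $ j * (if j \<in> C then x $ j else 0)) else 0)
        = (\<Sum>j\<in>UNIV. of_bool (i \<in> A \<and> j \<in> C) * (H $ i $ j * y $ i * x $ j))"
      proof (cases "i \<in> A")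
        case True
        then show ?thesis
          by (simp only: if_True sum_distrib_left) (rule sum.cong[OF refl], simp)
      qed simp
    qed
    finally show ?thesis .
  qed
  have avg: "y \<bullet> rst I (H *v rst I x)
    = ?E (\<lambda>B. 2 * (y \<bullet> rst (I \<inter> B) (H *v rst (I - B) x) + y \<bullet> rst (I - B) (H *v rst (I \<inter> B) x)))" for x y
  proof -
    have "?E (\<lambda>B. 2 * (y \<bullet> rst (I \<inter> B) (H *v rst (I - B) x) + y \<bullet> rst (I - B) (H *v rst (I \<inter> B) x)))
      = ?E (\<lambda>B. \<Sum>i\<in>UNIV. \<Sum>j\<in>UNIV. (2 * of_bool (i \<in> I \<and> j \<in> I) * (H $ i $ j * y $ i * x $ j)) * of_bool ((i \<in> B) \<noteq> (j \<in> B)))"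
      unfolding form sum.distrib[symmetric] sum_distrib_left by (intro PE_cong sum.cong) auto
    also have "\<dots> = (\<Sum>i\<in>UNIV. \<Sum>j\<in>UNIV. (2 * of_bool (i \<in> I \<and> j \<in> I) * (H $ i $ j * y $ i * x $ j))
        * ?E (\<lambda>B. of_bool ((i \<in> B) \<noteq> (j \<in> B))))"
      by (simp only: PE_sum PE_cmult)
    \<comment> \<open>Pairs \<open>i = j\<close> are never separated, but there \<open>H\<close>
      vanishes; for the others the factor 2 cancels.\<close>
    also have "\<dots> = (\<Sum>i\<in>UNIV. \<Sum>j\<in>UNIV. of_bool (i \<in> I \<and> j \<in> I) * (H $ i $ j * y $ i * x $ j))"
    proof (intro sum.cong refl)
      fix i j :: 'k
      show "2 * of_bool (i \<in> I \<and> j \<in> I) * (H $ i $ j * y $ i * x $ j) * ?E (\<lambda>B. of_bool ((i \<in> B) \<noteq> (j \<in> B)))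
        = of_bool (i \<in> I \<and> j \<in> I) * (H $ i $ j * y $ i * x $ j)"
        by (cases "i = j") (use hollow PE_half_separated[of UNIV i j] in auto)
    qed
    finally show ?thesis by (simp add: form)
  qed
  have block: "y \<bullet> rst A (H *v rst C x) + y \<bullet> rst C (H *v rst A x) \<le> sub_norm H A C * (norm y * norm x)"
    if AC: "A \<inter> C = {}" for A C and x y :: "real^'k"
  proof -
    let ?n = "sub_norm H A C"
    let ?u = "rst A (H *v rst C x)" and ?v = "rst C (H *v rst A x)"
    have dis: "(norm (rst A z))\<^sup>2 + (norm (rst C z))\<^sup>2 \<le> (norm z)\<^sup>2" for z :: "real^'k"
    proof -
      have "(norm (rst A z))\<^sup>2 + (norm (rst C z))\<^sup>2 = (norm (rst (A \<union> C) z))\<^sup>2"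
        unfolding norm_rst_sq using AC by (subst sum.union_disjoint) auto
      then show ?thesis using norm_rst_le[of "A \<union> C" z] by (simp add: power_mono)
    qed
    have nu: "norm ?u \<le> ?n * norm (rst C x)"
      using sub_norm_bound[of A H C "rst C x"] by (simp add: rst_rst)
    have nv: "norm ?v \<le> ?n * norm (rst A x)"
      using sub_norm_bound[of C H A "rst A x"] by (simp add: rst_rst sub_norm_commute[OF sym, of C A])
    have "y \<bullet> ?u \<le> norm (rst A y) * norm ?u"
      using norm_cauchy_schwarz[of "rst A y" ?u] by (simp add: rst_inner rst_rst)
    also have "\<dots> \<le> norm (rst A y) * (?n * norm (rst C x))" by (intro mult_left_mono nu) simp
    finally have u: "y \<bullet> ?u \<le> norm (rst A y) * (?n * norm (rst C x))" .
    have "y \<bullet> ?v \<le> norm (rst C y) * norm ?v"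
      using norm_cauchy_schwarz[of "rst C y" ?v] by (simp add: rst_inner rst_rst)
    also have "\<dots> \<le> norm (rst C y) * (?n * norm (rst A x))" by (intro mult_left_mono nv) simp
    finally have v: "y \<bullet> ?v \<le> norm (rst C y) * (?n * norm (rst A x))" .
    have "y \<bullet> ?u + y \<bullet> ?v \<le> norm (rst A y) * (?n * norm (rst C x)) + norm (rst C y) * (?n * norm (rst A x))"
      by (rule add_mono[OF u v])
    also have "\<dots> = ?n * (norm (rst A y) * norm (rst C x) + norm (rst C y) * norm (rst A x))"
      by (simp add: algebra_simps)
    also have "\<dots> \<le> ?n * (norm y * norm x)"
    proof (intro mult_left_mono sub_norm_nonneg)
      let ?a = "norm (rst A y)" and ?b = "norm (rst C y)" and ?c = "norm (rst C x)" and ?d = "norm (rst A x)"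
      \<comment> \<open>Lagrange's identity, that is, Cauchy-Schwarz in the plane.\<close>
      have "(?a * ?c + ?b * ?d)\<^sup>2 \<le> (?a * ?c + ?b * ?d)\<^sup>2 + (?a * ?d - ?b * ?c)\<^sup>2" by simp
      also have "\<dots> = (?a\<^sup>2 + ?b\<^sup>2) * (?d\<^sup>2 + ?c\<^sup>2)" by (simp add: power2_eq_square algebra_simps)
      also have "\<dots> \<le> (norm y)\<^sup>2 * (norm x)\<^sup>2" by (intro mult_mono dis) auto
      finally have "(?a * ?c + ?b * ?d)\<^sup>2 \<le> (norm y * norm x)\<^sup>2" by (simp add: power_mult_distrib)
      then show "?a * ?c + ?b * ?d \<le> norm y * norm x" by (rule power2_le_imp_le) simp
    qed
    finally show ?thesis .
  qed
  have bil: "y \<bullet> rst I (H *v rst I x) \<le> b * (norm y * norm x)" for x y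
  proof -
    have "y \<bullet> rst I (H *v rst I x) \<le> ?E (\<lambda>B. (norm y * norm x) * (2 * sub_norm H (I \<inter> B) (I - B)))"
      unfolding avg
    proof (intro PE_mono)
      fix B
      have "(I \<inter> B) \<inter> (I - B) = {}" by auto
      from block[OF this, of y x]
      show "2 * (y \<bullet> rst (I \<inter> B) (H *v rst (I - B) x) + y \<bullet> rst (I - B) (H *v rst (I \<inter> B) x))
        \<le> norm y * norm x * (2 * sub_norm H (I \<inter> B) (I - B))" by (simp add: mult_ac)
    qed auto
    also have "\<dots> = b * (norm y * norm x)" by (simp add: PE_cmult b_def)
    finally show ?thesis .
  qed
  show ?thesis
    unfolding b_def[symmetric]
  proof (rule sub_norm_le[OF b0])
    fix x
    let ?u = "rst I (H *v rst I x)"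
    have "norm ?u * norm ?u \<le> (b * norm x) * norm ?u"
      using bil[of ?u x] by (simp add: norm_eq_sqrt_inner mult_ac)
    then show "norm ?u \<le> b * norm x" using b0 by (cases "?u = 0") auto
  qed
qed

text \<open>Discrete layer-cake bound: a positive \<open>u\<close> exceeds \<open>u / s\<close>,
  rounded up, of the thresholds \<open>k * s\<close>, and the second assumption ensures that
  \<open>n\<close> layers are enough.\<close>

lemma pos_part_layer_sum:
  fixes s u :: real
  assumes "0 \<le> s" "u \<le> real n * s"
  shows "max 0 u \<le> s * (\<Sum>k<n. of_bool (real k * s < u))"
  using assms(2)
proof (induction n)
  case (Suc n)
  show ?case
  proof (cases "u \<le> real n * s")
    case True
    then have "max 0 u \<le> s * (\<Sum>k<n. of_bool (real k * s < u))" by (rule Suc.IH)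
    also have "\<dots> \<le> s * (\<Sum>k<Suc n. of_bool (real k * s < u))"
      using assms(1) by (intro mult_left_mono) auto
    finally show ?thesis .
  next
    case False
    have "real k * s < u" if "k < Suc n" for k
    proof -
      have "real k * s \<le> real n * s" using that assms(1) by (intro mult_right_mono) auto
      then show ?thesis using False by simp
    qed
    then have "(\<Sum>k<Suc n. of_bool (real k * s < u)) = real (Suc n)" by simp
    then have "s * (\<Sum>k<Suc n. of_bool (real k * s < u)) = real (Suc n) * s" by (simp only: mult.commute)
    moreover have "0 \<le> real (Suc n) * s" using assms(1) by simp
    then have "max 0 u \<le> real (Suc n) * s" using Suc.prems by (rule max.boundedI)
    ultimately show ?thesis by (simp only:)
  qed
qed simp

section \<open>Tail bounds for blocks under Poisson sampling\<close>

definition wt :: "('k \<Rightarrow> real) \<Rightarrow> real^'k \<Rightarrow> real^'k" where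
  "wt p x = (\<chi> i. sqrt (p i) * x $ i)"

lemma wt_nth [simp]: "wt p x $ i = sqrt (p i) * x $ i"
  by (simp add: wt_def)

lemma wt_inner: "wt p x \<bullet> y = x \<bullet> wt p y"
  by (simp add: inner_vec_def mult_ac)

lemma of_bool_mono: "(P \<longrightarrow> Q) \<Longrightarrow> of_bool P \<le> (of_bool Q :: real)"
  by auto

text \<open>The conditions on the dictionary in squared form, \<open>L\<close> being the logarithm:
  \<open>entries\<close> comes from the coherence, \<open>rows\<close> from the weighted row norms,
  \<open>weighted\<close> from the spectral norm.\<close>

locale hollow_sampling =
  fixes H :: "real^'k^'k" and p :: "'k \<Rightarrow> real" and L :: real
  assumes sym: "transpose H = H" and hollow: "\<And>i. H $ i $ i = 0"
    and p: "\<And>i. 0 \<le> p i" "\<And>i. p i \<le> 1" and L: "1 \<le> L"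
    and entries: "\<And>i j. (H $ i $ j)\<^sup>2 \<le> 1 / (16 * L\<^sup>2)"
    and rows: "\<And>j. (\<Sum>i\<in>UNIV. p i * (H $ j $ i)\<^sup>2) \<le> 1 / (16 * exp 2 * L)"
    and weighted: "\<And>x. (norm (wt p (H *v wt p x)))\<^sup>2 \<le> (norm x)\<^sup>2 / (16 * (exp 2)\<^sup>2)"
begin

lemma row_inner: "H $ j \<bullet> x = (H *v x) $ j"
  by (simp add: matrix_vector_mult_def inner_vec_def)

lemma PE_le_1: assumes "\<And>I. f I \<le> 1" shows "PE p UNIV f \<le> 1"
proof -
  have "PE p UNIV f \<le> PE p UNIV (\<lambda>_. 1)" using assms by (intro PE_mono p)
  then show ?thesis by (simp add: PE_const)
qed

text \<open>Matrix Chernoff in dimension one: \<open>M\<close> is the bound in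
  \<open>entries\<close>, and \<open>s\<close> is \<open>exp 2\<close> times the bound in
  \<open>rows\<close>.\<close>

lemma row_tail:
  "PE p UNIV (\<lambda>I. of_bool (y / (16 * L) < (\<Sum>i\<in>I. (H $ j $ i)\<^sup>2))) \<le> exp ((1 - 2 * y) * L)"
proof -
  have "PE p UNIV (\<lambda>I. of_bool (\<exists>x::real. norm x = 1 \<and> y / (16 * L) < (\<Sum>i\<in>I. (H $ j $ i \<bullet> x)\<^sup>2)))
    \<le> DIM(real) * exp ((1 / (16 * L) - 2 * (y / (16 * L))) / (1 / (16 * L\<^sup>2)))"
  proof (rule matrix_chernoff)
    fix x :: real
    have "exp 2 * (\<Sum>i\<in>UNIV. p i * (H $ j $ i \<bullet> x)\<^sup>2) = exp 2 * (\<Sum>i\<in>UNIV. p i * (H $ j $ i)\<^sup>2) * x\<^sup>2"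
      by (simp add: power_mult_distrib sum_distrib_right sum_distrib_left mult_ac)
    also have "\<dots> \<le> exp 2 * (1 / (16 * exp 2 * L)) * x\<^sup>2"
      by (intro mult_right_mono mult_left_mono rows) auto
    finally show "exp 2 * (\<Sum>i\<in>UNIV. p i * (H $ j $ i \<bullet> x)\<^sup>2) \<le> 1 / (16 * L) * (norm x)\<^sup>2" by simp
  next
    show "(norm (H $ j $ i))\<^sup>2 \<le> 1 / (16 * L\<^sup>2)" for i using entries[of j i] by simp
  qed (use L in \<open>simp_all add: p(1) p(2)\<close>)
  also have "(1 / (16 * L) - 2 * (y / (16 * L))) / (1 / (16 * L\<^sup>2)) = (1 - 2 * y) * L"
    using L by (simp add: field_simps power2_eq_square)
  also have "DIM(real) * exp ((1 - 2 * y) * L) = exp ((1 - 2 * y) * L)" by simp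
  finally show ?thesis
  proof (rule order_trans[rotated], intro PE_mono p)
    fix I :: "'k set"
    show "of_bool (y / (16 * L) < (\<Sum>i\<in>I. (H $ j $ i)\<^sup>2))
      \<le> (of_bool (\<exists>x::real. norm x = 1 \<and> y / (16 * L) < (\<Sum>i\<in>I. (H $ j $ i \<bullet> x)\<^sup>2)) :: real)"
      by (rule of_bool_mono) (auto intro!: exI[of _ 1])
  qed
qed

text \<open>Matrix Chernoff for the rows of \<open>H\<close> with weighted columns:
  \<open>rows\<close> bounds their squared lengths, \<open>weighted\<close> the mean of the sum of
  their rank-one operators.\<close>

lemma weighted_tail:
  "PE p UNIV (\<lambda>I. of_bool (\<exists>x. norm x = 1 \<and> z / (16 * exp 2) < (norm (rst I (H *v wt p x)))\<^sup>2))
    \<le> CARD('k) * exp ((1 - 2 * z) * L)"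
proof -
  have eq: "(\<Sum>i\<in>I. (wt p (H $ i) \<bullet> x)\<^sup>2) = (norm (rst I (H *v wt p x)))\<^sup>2" for I x
    by (simp add: norm_rst_sq wt_inner row_inner)
  have "PE p UNIV (\<lambda>I. of_bool (\<exists>x. norm x = 1 \<and> z / (16 * exp 2) < (\<Sum>i\<in>I. (wt p (H $ i) \<bullet> x)\<^sup>2)))
    \<le> DIM(real^'k) * exp ((1 / (16 * exp 2) - 2 * (z / (16 * exp 2))) / (1 / (16 * exp 2 * L)))"
  proof (rule matrix_chernoff)
    fix i
    have "(norm (wt p (H $ i)))\<^sup>2 = (\<Sum>j\<in>UNIV. p j * (H $ i $ j)\<^sup>2)"
      by (simp add: norm_sq_sum power_mult_distrib p)
    then show "(norm (wt p (H $ i)))\<^sup>2 \<le> 1 / (16 * exp 2 * L)" using rows by simp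
  next
    fix x :: "real^'k"
    have "(\<Sum>i\<in>UNIV. p i * (wt p (H $ i) \<bullet> x)\<^sup>2) = (norm (wt p (H *v wt p x)))\<^sup>2"
      by (simp add: norm_sq_sum power_mult_distrib p wt_inner row_inner)
    also have "\<dots> \<le> (norm x)\<^sup>2 / (16 * (exp 2)\<^sup>2)" by (rule weighted)
    finally have "exp 2 * (\<Sum>i\<in>UNIV. p i * (wt p (H $ i) \<bullet> x)\<^sup>2) \<le> exp 2 * ((norm x)\<^sup>2 / (16 * (exp 2)\<^sup>2))"
      by (rule mult_left_mono) simp
    then show "exp 2 * (\<Sum>i\<in>UNIV. p i * (wt p (H $ i) \<bullet> x)\<^sup>2) \<le> 1 / (16 * exp 2) * (norm x)\<^sup>2"
      by (simp add: power2_eq_square)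
  qed (use L in \<open>simp_all add: p(1) p(2)\<close>)
  also have "(1 / (16 * exp 2) - 2 * (z / (16 * exp 2))) / (1 / (16 * exp 2 * L)) = (1 - 2 * z) * L"
    using L by (simp add: field_simps)
  also have "DIM(real^'k) = CARD('k)" by simp
  finally show ?thesis by (simp only: eq)
qed

text \<open>With \<open>I\<close> fixed, matrix Chernoff for the rows of \<open>H\<close> restricted
  to \<open>I\<close>: \<open>r\<close> provides \<open>M\<close>, and \<open>s = z / 16\<close>
  comes from \<open>w\<close>, whose operator is the adjoint of the one that governs the
  mean.\<close>

lemma conditional_tail:
  assumes y: "0 < y" and z: "0 \<le> z"
    and r: "\<And>j. (\<Sum>i\<in>I. (H $ j $ i)\<^sup>2) \<le> y / (16 * L)"
    and w: "\<And>x. norm x = 1 \<Longrightarrow> (norm (rst I (H *v wt p x)))\<^sup>2 \<le> z / (16 * exp 2)"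
  shows "PE p UNIV (\<lambda>J. of_bool (\<exists>x. norm x = 1 \<and> \<rho>\<^sup>2 / 16 < (norm (rst J (H *v rst I x)))\<^sup>2))
    \<le> CARD('k) * exp ((z - 2 * \<rho>\<^sup>2) * L / y)"
proof -
  have eq: "(\<Sum>j\<in>J. (rst I (H $ j) \<bullet> x)\<^sup>2) = (norm (rst J (H *v rst I x)))\<^sup>2" for J x
    by (simp add: norm_rst_sq rst_inner row_inner)
  have "PE p UNIV (\<lambda>J. of_bool (\<exists>x. norm x = 1 \<and> \<rho>\<^sup>2 / 16 < (\<Sum>j\<in>J. (rst I (H $ j) \<bullet> x)\<^sup>2)))
    \<le> DIM(real^'k) * exp ((z / 16 - 2 * (\<rho>\<^sup>2 / 16)) / (y / (16 * L)))"
  proof (rule matrix_chernoff)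
    fix j
    show "(norm (rst I (H $ j)))\<^sup>2 \<le> y / (16 * L)" using r by (simp add: norm_rst_sq)
  next
    fix x :: "real^'k"
    define u where "u = wt p (H *v rst I x)"
    have nb: "(norm (rst I (H *v wt p v)))\<^sup>2 \<le> z / (16 * exp 2) * (norm v)\<^sup>2" for v
    proof (cases "v = 0")
      case True
      have "wt p v = 0" "rst I (0 :: real^'k) = 0" using True by (simp_all add: vec_eq_iff)
      then show ?thesis using True by simp
    next
      case False
      have "wt p (v /\<^sub>R norm v) = wt p v /\<^sub>R norm v" by (simp add: vec_eq_iff)
      then have "rst I (H *v wt p (v /\<^sub>R norm v)) = rst I (H *v wt p v) /\<^sub>R norm v"
        by (simp only: linear_scale[OF linear_rst[of I]] linear_scale[OF matrix_vector_mul_linear[of H]])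
      then have "norm (rst I (H *v wt p (v /\<^sub>R norm v))) = norm (rst I (H *v wt p v)) / norm v"
        by (simp only: norm_scaleR abs_inverse abs_norm_cancel divide_inverse mult.commute)
      moreover have "norm (v /\<^sub>R norm v) = 1" using False by simp
      ultimately have "(norm (rst I (H *v wt p v)) / norm v)\<^sup>2 \<le> z / (16 * exp 2)"
        using w[of "v /\<^sub>R norm v"] by (simp only:)
      then show ?thesis using False by (simp add: power_divide divide_le_eq)
    qed
    have "norm u * norm u = u \<bullet> u" by (simp add: norm_eq_sqrt_inner)
    also have "\<dots> = x \<bullet> rst I (H *v wt p u)"
      by (simp only: u_def wt_inner rst_inner symmetric_matrix_inner[OF sym])
    also have "\<dots> \<le> norm x * norm (rst I (H *v wt p u))" by (rule norm_cauchy_schwarz)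
    finally have "(norm u * norm u)\<^sup>2 \<le> (norm x * norm (rst I (H *v wt p u)))\<^sup>2"
      by (rule power_mono) simp
    also have "\<dots> \<le> (norm x)\<^sup>2 * (z / (16 * exp 2) * (norm u)\<^sup>2)"
      unfolding power_mult_distrib by (intro mult_left_mono nb) simp
    finally have "(norm u)\<^sup>2 * (norm u)\<^sup>2 \<le> (z / (16 * exp 2) * (norm x)\<^sup>2) * (norm u)\<^sup>2"
      by (simp only: power_mult_distrib mult_ac)
    then have "(norm u)\<^sup>2 \<le> z / (16 * exp 2) * (norm x)\<^sup>2"
      using z by (cases "u = 0") (simp, rule mult_right_le_imp_le, assumption, simp)
    moreover have "(\<Sum>j\<in>UNIV. p j * (rst I (H $ j) \<bullet> x)\<^sup>2) = (norm u)\<^sup>2"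
      by (simp add: norm_sq_sum power_mult_distrib p rst_inner row_inner u_def)
    ultimately have "exp 2 * (\<Sum>j\<in>UNIV. p j * (rst I (H $ j) \<bullet> x)\<^sup>2) \<le> exp 2 * (z / (16 * exp 2) * (norm x)\<^sup>2)"
      by (intro mult_left_mono) auto
    then show "exp 2 * (\<Sum>j\<in>UNIV. p j * (rst I (H $ j) \<bullet> x)\<^sup>2) \<le> z / 16 * (norm x)\<^sup>2" by simp
  qed (use L y z in \<open>simp_all add: p(1) p(2)\<close>)
  also have "(z / 16 - 2 * (\<rho>\<^sup>2 / 16)) / (y / (16 * L)) = (z - 2 * \<rho>\<^sup>2) * L / y"
    using L y by (simp add: field_simps)
  also have "DIM(real^'k) = CARD('k)" by simp
  finally show ?thesis by (simp only: eq)
qed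

text \<open>Union bound: if some row is long or the weighted matrix is large, the inner probability
  is bounded by 1; otherwise \<open>conditional_tail\<close> applies to the given
  \<open>I\<close>.\<close>

lemma bipartite_tail:
  assumes y: "0 < y" and z: "0 \<le> z" and \<rho>: "0 \<le> \<rho>"
  shows "PE p UNIV (\<lambda>I. PE p UNIV (\<lambda>J. of_bool (\<rho> < 4 * sub_norm H I J)))
    \<le> CARD('k) * (exp ((1 - 2 * y) * L) + exp ((1 - 2 * z) * L) + exp ((z - 2 * \<rho>\<^sup>2) * L / y))"
proof -
  let ?R = "\<lambda>j I. of_bool (y / (16 * L) < (\<Sum>i\<in>I. (H $ j $ i)\<^sup>2)) :: real"
  let ?W = "\<lambda>I. of_bool (\<exists>x. norm x = 1 \<and> z / (16 * exp 2) < (norm (rst I (H *v wt p x)))\<^sup>2) :: real"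
  let ?c = "CARD('k) * exp ((z - 2 * \<rho>\<^sup>2) * L / y)"
  have "PE p UNIV (\<lambda>J. of_bool (\<rho> < 4 * sub_norm H I J)) \<le> (\<Sum>j\<in>UNIV. ?R j I) + ?W I + ?c" for I
  proof (cases "(\<exists>j. ?R j I = 1) \<or> ?W I = 1")
    case True
    have "PE p UNIV (\<lambda>J. of_bool (\<rho> < 4 * sub_norm H I J)) \<le> 1" by (rule PE_le_1) simp
    also have "1 \<le> (\<Sum>j\<in>UNIV. ?R j I) + ?W I"
    proof (cases "?W I = 1")
      case False
      then obtain j where "?R j I = 1" using True by blast
      then have "1 \<le> (\<Sum>j\<in>UNIV. ?R j I)" using member_le_sum[of j UNIV "\<lambda>j. ?R j I"] by simp
      then show ?thesis by simp
    qed (simp add: sum_nonneg)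
    also have "\<dots> \<le> (\<Sum>j\<in>UNIV. ?R j I) + ?W I + ?c" by simp
    finally show ?thesis .
  next
    case False
    have r: "(\<Sum>i\<in>I. (H $ j $ i)\<^sup>2) \<le> y / (16 * L)" for j
      using False by (simp add: not_less)
    have w: "(norm (rst I (H *v wt p x)))\<^sup>2 \<le> z / (16 * exp 2)" if "norm x = 1" for x
      using False that by (auto simp: not_less)
    have "\<exists>x. norm x = 1 \<and> \<rho>\<^sup>2 / 16 < (norm (rst J (H *v rst I x)))\<^sup>2" if J: "\<rho> < 4 * sub_norm H I J" for J
    proof -
      have "\<rho> / 4 < sub_norm H J I" using J by (simp add: sub_norm_commute[OF sym, of J I])
      then obtain x where x: "norm x = 1" "\<rho> / 4 < norm (rst J (H *v rst I x))"
        using sub_norm_gt_witness[of "\<rho> / 4" H J I] \<rho> by auto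
      have "(\<rho> / 4)\<^sup>2 < (norm (rst J (H *v rst I x)))\<^sup>2"
        using x(2) \<rho> by (intro power_strict_mono) auto
      then show ?thesis using x(1) by (auto simp: power_divide)
    qed
    then have "PE p UNIV (\<lambda>J. of_bool (\<rho> < 4 * sub_norm H I J))
      \<le> PE p UNIV (\<lambda>J. of_bool (\<exists>x. norm x = 1 \<and> \<rho>\<^sup>2 / 16 < (norm (rst J (H *v rst I x)))\<^sup>2))"
      by (intro PE_mono p of_bool_mono impI)
    also have "\<dots> \<le> ?c" by (rule conditional_tail[OF y z r w])
    also have "\<dots> \<le> (\<Sum>j\<in>UNIV. ?R j I) + ?W I + ?c" by (simp add: sum_nonneg)
    finally show ?thesis .
  qed
  then have "PE p UNIV (\<lambda>I. PE p UNIV (\<lambda>J. of_bool (\<rho> < 4 * sub_norm H I J)))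
     \<le> PE p UNIV (\<lambda>I. (\<Sum>j\<in>UNIV. ?R j I) + ?W I + ?c)"
    by (intro PE_mono p)
  also have "\<dots> = (\<Sum>j\<in>UNIV. PE p UNIV (?R j)) + PE p UNIV ?W + ?c"
    by (simp only: PE_add PE_sum PE_const finite)
  also have "\<dots> \<le> (\<Sum>j\<in>(UNIV::'k set). exp ((1 - 2 * y) * L)) + CARD('k) * exp ((1 - 2 * z) * L) + ?c"
    by (intro add_mono sum_mono row_tail weighted_tail order_refl)
  also have "\<dots> = CARD('k) * (exp ((1 - 2 * y) * L) + exp ((1 - 2 * z) * L) + exp ((z - 2 * \<rho>\<^sup>2) * L / y))"
    by (simp add: algebra_simps)
  finally show ?thesis .
qed

text \<open>The value \<open>?y\<close>, used for \<open>z\<close> as well, makes the first two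
  exponents equal to \<open>- \<rho> * L\<close>; the third is no larger because
  \<open>(3 * \<rho> + 1) * (\<rho> - 1) \<ge> 0\<close>.\<close>

lemma bipartite_tail_ge_1:
  assumes "1 \<le> \<rho>"
  shows "PE p UNIV (\<lambda>I. PE p UNIV (\<lambda>J. of_bool (\<rho> < 4 * sub_norm H I J))) \<le> 3 * CARD('k) * exp (- \<rho> * L)"
proof -
  let ?y = "(1 + \<rho>) / 2"
  have "3 * \<rho>\<^sup>2 - 2 * \<rho> - 1 = (3 * \<rho> + 1) * (\<rho> - 1)" by (simp add: power2_eq_square algebra_simps)
  also have "\<dots> \<ge> 0" using assms by simp
  finally have "?y - 2 * \<rho>\<^sup>2 \<le> - \<rho> * ?y" by (simp add: power2_eq_square field_simps)
  then have "(?y - 2 * \<rho>\<^sup>2) * L \<le> - \<rho> * ?y * L" using L by (intro mult_right_mono) auto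
  then have "(?y - 2 * \<rho>\<^sup>2) * L / ?y \<le> - \<rho> * L"
    using assms by (simp only: divide_le_eq) (simp add: mult_ac)
  then have e: "exp ((?y - 2 * \<rho>\<^sup>2) * L / ?y) \<le> exp (- \<rho> * L)" by (simp only: exp_le_cancel_iff)
  have y: "1 - 2 * ?y = - \<rho>" by (simp add: field_simps)
  have "PE p UNIV (\<lambda>I. PE p UNIV (\<lambda>J. of_bool (\<rho> < 4 * sub_norm H I J)))
    \<le> CARD('k) * (exp (- \<rho> * L) + exp (- \<rho> * L) + exp ((?y - 2 * \<rho>\<^sup>2) * L / ?y))"
    using bipartite_tail[of ?y ?y \<rho>] assms unfolding y by simp
  also have "\<dots> \<le> CARD('k) * (exp (- \<rho> * L) + exp (- \<rho> * L) + exp (- \<rho> * L))"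
    using e by (intro mult_left_mono add_mono order_refl) auto
  finally show ?thesis by simp
qed

text \<open>With \<open>y = z = 1\<close>, a threshold \<open>1 / (2 * L)\<close> below 1 costs only
  the factor \<open>exp 2\<close> in the third term.\<close>

lemma bipartite_tail_threshold:
  "PE p UNIV (\<lambda>I. PE p UNIV (\<lambda>J. of_bool (1 - 1 / (2 * L) < 4 * sub_norm H I J)))
    \<le> (2 + exp 2) * CARD('k) * exp (- L)"
proof -
  let ?r = "1 - 1 / (2 * L)"
  have "(1 - 2 * ?r\<^sup>2) * L = - L + 2 - 1 / (2 * L)" using L by (simp add: field_simps power2_eq_square)
  then have "(1 - 2 * ?r\<^sup>2) * L / 1 \<le> 2 + - L" using L by simp
  then have e: "exp ((1 - 2 * ?r\<^sup>2) * L / 1) \<le> exp (2 + - L)" by (simp only: exp_le_cancel_iff)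
  have "PE p UNIV (\<lambda>I. PE p UNIV (\<lambda>J. of_bool (?r < 4 * sub_norm H I J)))
    \<le> CARD('k) * (exp ((1 - 2 * 1) * L) + exp ((1 - 2 * 1) * L) + exp ((1 - 2 * ?r\<^sup>2) * L / 1))"
    using L by (intro bipartite_tail) auto
  also have "\<dots> \<le> CARD('k) * (exp ((1 - 2 * 1) * L) + exp ((1 - 2 * 1) * L) + exp (2 + - L))"
    using e by (intro mult_left_mono add_mono order_refl) auto
  also have "\<dots> = (2 + exp 2) * CARD('k) * exp (- L)" unfolding exp_add by (simp add: algebra_simps)
  finally show ?thesis .
qed

text \<open>Layers of width \<open>s\<close> start at \<open>1 - s\<close>: the first contributes
  \<open>2 + exp 2\<close>, and the others decay by \<open>exp (- 1 / 2)\<close> per layer because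
  \<open>s * L = 1 / 2\<close>. The total is at most
  \<open>2 + 7.5 + 3 * (8 / 3) = 17.5\<close>.\<close>

lemma excess_expectation:
  "PE p UNIV (\<lambda>I. PE p UNIV (\<lambda>J. max 0 (4 * sub_norm H I J - (1 - 1 / (2 * L)))))
    \<le> 1 / (2 * L) * (17.5 * CARD('k) * exp (- L))"
proof -
  define s where "s = 1 / (2 * L)"
  have s: "0 < s" using L by (simp add: s_def)
  \<comment> \<open>Enough layers for every block, since no block norm exceeds that of the whole
    matrix.\<close>
  define m where "m = nat \<lceil>(4 * sub_norm H UNIV UNIV) / s\<rceil>"
  let ?T = "\<lambda>k. PE p UNIV (\<lambda>I. PE p UNIV (\<lambda>J. of_bool (real k * s < 4 * sub_norm H I J - (1 - s))))"
  have bound: "4 * sub_norm H I J - (1 - s) \<le> real (Suc m) * s" for I J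
  proof -
    have "4 * sub_norm H UNIV UNIV / s \<le> real m" unfolding m_def by linarith
    then have "4 * sub_norm H UNIV UNIV \<le> real m * s" using s by (simp add: divide_le_eq)
    moreover have "sub_norm H I J \<le> sub_norm H UNIV UNIV" by (rule sub_norm_mono) auto
    ultimately show ?thesis using s by (simp add: algebra_simps)
  qed
  have T0: "?T 0 \<le> (2 + exp 2) * CARD('k) * exp (- L)"
    using bipartite_tail_threshold by (simp add: s_def)
  have T: "?T (Suc k) \<le> 3 * CARD('k) * exp (- L) * exp (- 1 / 2) ^ k" for k
  proof -
    have "?T (Suc k) = PE p UNIV (\<lambda>I. PE p UNIV (\<lambda>J. of_bool (1 + real k * s < 4 * sub_norm H I J)))"
      by (intro PE_cong arg_cong[where f = of_bool]) (auto simp: algebra_simps)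
    also have "\<dots> \<le> 3 * CARD('k) * exp (- (1 + real k * s) * L)"
      using s by (intro bipartite_tail_ge_1) simp
    also have "- (1 + real k * s) * L = - L + real k * (- 1 / 2)" using L by (simp add: s_def field_simps)
    finally show ?thesis unfolding exp_add exp_of_nat_mult by (simp add: mult_ac)
  qed
  have geo: "(\<Sum>k<m. exp (- 1 / 2) ^ k) \<le> (8 / 3 :: real)"
  proof -
    have "8 / 5 \<le> exp (1 / 2 :: real)"
      using exp_lower_Taylor_quadratic[of "1 / 2 :: real"] by (simp add: power2_eq_square)
    then have q: "exp (- 1 / 2) \<le> (5 / 8 :: real)" by (simp add: exp_minus field_simps)
    have "(\<Sum>k<m. exp (- 1 / 2 :: real) ^ k) \<le> (\<Sum>k<m. (5 / 8) ^ k)"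
      using q by (intro sum_mono power_mono) auto
    also have "\<dots> = (1 - (5 / 8) ^ m) / (1 - 5 / 8)" by (subst sum_gp_strict) simp
    also have "\<dots> \<le> 1 / (1 - 5 / 8)" by (intro divide_right_mono) auto
    also have "\<dots> = 8 / 3" by simp
    finally show ?thesis .
  qed
  have e2: "exp (2 :: real) \<le> 7.5"
  proof -
    have "exp (2 :: real) = exp 1 * exp 1" by (simp add: exp_add[symmetric])
    also have "\<dots> \<le> 2.72 * 2.72" using e_less_272 by (intro mult_mono) auto
    finally show ?thesis by simp
  qed
  have "PE p UNIV (\<lambda>I. PE p UNIV (\<lambda>J. max 0 (4 * sub_norm H I J - (1 - s))))
    \<le> PE p UNIV (\<lambda>I. PE p UNIV (\<lambda>J. s * (\<Sum>k<Suc m. of_bool (real k * s < 4 * sub_norm H I J - (1 - s)))))"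
    using s bound by (intro PE_mono p pos_part_layer_sum) auto
  also have "\<dots> = s * (\<Sum>k<Suc m. ?T k)" by (simp only: PE_cmult PE_sum)
  also have "(\<Sum>k<Suc m. ?T k) = ?T 0 + (\<Sum>k<m. ?T (Suc k))" by (rule sum.lessThan_Suc_shift)
  also have "s * (?T 0 + (\<Sum>k<m. ?T (Suc k)))
    \<le> s * ((2 + exp 2) * CARD('k) * exp (- L) + (\<Sum>k<m. 3 * CARD('k) * exp (- L) * exp (- 1 / 2) ^ k))"
    using s by (intro mult_left_mono add_mono T0 sum_mono T) auto
  also have "(\<Sum>k<m. 3 * CARD('k) * exp (- L) * exp (- 1 / 2) ^ k) = 3 * CARD('k) * exp (- L) * (\<Sum>k<m. exp (- 1 / 2) ^ k)"
    by (simp add: sum_distrib_left)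
  also have "s * ((2 + exp 2) * CARD('k) * exp (- L) + 3 * CARD('k) * exp (- L) * (\<Sum>k<m. exp (- 1 / 2) ^ k))
    \<le> s * ((2 + 7.5) * CARD('k) * exp (- L) + 3 * CARD('k) * exp (- L) * (8 / 3))"
    using s by (intro mult_left_mono add_mono mult_right_mono geo e2 order_refl) auto
  also have "\<dots> = s * (17.5 * CARD('k) * exp (- L))" by (simp add: algebra_simps)
  finally show ?thesis by (simp add: s_def)
qed

theorem principal_submatrix_tail:
  "PE p UNIV (\<lambda>I. of_bool (1 / 2 < sub_norm H I I)) \<le> 17.5 * CARD('k) * exp (- L)"
proof -
  define a where "a = 1 - 1 / (2 * L)"
  let ?f = "\<lambda>I J. max 0 (4 * sub_norm H I J - a)"
  let ?E = "PE (\<lambda>_. 1 / 2) (UNIV :: 'k set)"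
  \<comment> \<open>Markov's inequality for the excess over \<open>a\<close>. Taking \<open>a\<close> at distance \<open>1 / (2 L)\<close> below the threshold \<open>1\<close>
    costs a factor \<open>2 L\<close>, which the layers of width \<open>1 / (2 L)\<close> in \<open>excess_expectation\<close> cancel.\<close>
  have "of_bool (1 / 2 < sub_norm H I I) \<le> 2 * L * ?E (\<lambda>B. ?f (I \<inter> B) (I - B))" for I
  proof (cases "1 / 2 < sub_norm H I I")
    case True
    have "1 / (2 * L) \<le> 2 * sub_norm H I I - a" using True by (simp add: a_def)
    also have "\<dots> \<le> 2 * ?E (\<lambda>B. 2 * sub_norm H (I \<inter> B) (I - B)) - a"
      using sub_norm_decouple[OF sym hollow] by (intro diff_right_mono mult_left_mono) auto
    also have "\<dots> = ?E (\<lambda>B. 4 * sub_norm H (I \<inter> B) (I - B) - a)"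
      by (simp add: PE_diff PE_const PE_cmult)
    also have "\<dots> \<le> ?E (\<lambda>B. ?f (I \<inter> B) (I - B))" by (intro PE_mono) auto
    finally have "2 * L * (1 / (2 * L)) \<le> 2 * L * ?E (\<lambda>B. ?f (I \<inter> B) (I - B))"
      using L by (intro mult_left_mono) auto
    then show ?thesis using L True by simp
  next
    case False
    have "0 \<le> ?E (\<lambda>B. ?f (I \<inter> B) (I - B))" by (intro PE_nonneg) auto
    then show ?thesis using False L by simp
  qed
  then have "PE p UNIV (\<lambda>I. of_bool (1 / 2 < sub_norm H I I))
    \<le> PE p UNIV (\<lambda>I. 2 * L * ?E (\<lambda>B. ?f (I \<inter> B) (I - B)))"
    by (intro PE_mono p)
  \<comment> \<open>The averages are exchanged because \<open>PE_decouple\<close> needs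
    \<open>B\<close> fixed while \<open>I\<close> is drawn.\<close>
  also have "\<dots> = 2 * L * ?E (\<lambda>B. PE p UNIV (\<lambda>I. ?f (I \<inter> B) (I - B)))"
    unfolding PE_cmult by (simp only: PE_swap[of p])
  also have "\<dots> \<le> 2 * L * ?E (\<lambda>B. PE p UNIV (\<lambda>I. PE p UNIV (\<lambda>J. ?f I J)))"
  proof (rule mult_left_mono, rule PE_mono)
    fix B
    show "PE p UNIV (\<lambda>I. ?f (I \<inter> B) (I - B)) \<le> PE p UNIV (\<lambda>I. PE p UNIV (\<lambda>J. ?f I J))"
    proof (rule PE_decouple[where \<phi> = ?f])
      fix I I' J J' :: "'k set" assume "I \<subseteq> I'" "J \<subseteq> J'"
      then have "sub_norm H I J \<le> sub_norm H I' J'" by (rule sub_norm_mono)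
      then show "?f I J \<le> ?f I' J'" by (intro max.mono) auto
    qed (auto simp: p)
  qed (use L in auto)
  also have "\<dots> = 2 * L * PE p UNIV (\<lambda>I. PE p UNIV (\<lambda>J. ?f I J))" by (simp add: PE_const)
  also have "\<dots> \<le> 2 * L * (1 / (2 * L) * (17.5 * CARD('k) * exp (- L)))"
    using L by (intro mult_left_mono excess_expectation[folded a_def]) auto
  finally show ?thesis using L by simp
qed

end

section \<open>A dual certificate for Basis Pursuit\<close>

lemma matrix_vector_inner: "(\<Phi> *v z) \<bullet> u = (\<Sum>j\<in>UNIV. z $ j * (column j \<Phi> \<bullet> u))"
  for \<Phi> :: "real^'k^'d"
proof -
  have "(\<Phi> *v z) \<bullet> u = (\<Sum>i\<in>UNIV. \<Sum>j\<in>UNIV. z $ j * (\<Phi> $ i $ j * u $ i))"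
    by (simp add: inner_vec_def matrix_vector_mult_def sum_distrib_left sum_distrib_right mult_ac)
  also have "\<dots> = (\<Sum>j\<in>UNIV. \<Sum>i\<in>UNIV. z $ j * (\<Phi> $ i $ j * u $ i))" by (rule sum.swap)
  finally show ?thesis by (simp add: inner_vec_def column_def sum_distrib_left)
qed

text \<open>Pairing with the dual vector \<open>u\<close> bounds the l1 norm from below, with
  equality at \<open>x\<close>. Any other minimiser has equality in every coordinate, hence is
  supported on \<open>I\<close>, where injectivity identifies it with \<open>x\<close>.\<close>

lemma bp_recovers_certificate:
  fixes \<Phi> :: "real^'k^'d" and x :: "real^'k"
  assumes on: "\<And>i. i \<in> I \<Longrightarrow> column i \<Phi> \<bullet> u = sgn (x $ i)"
    and off: "\<And>i. i \<notin> I \<Longrightarrow> x $ i = 0" "\<And>i. i \<notin> I \<Longrightarrow> \<bar>column i \<Phi> \<bullet> u\<bar> < 1"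
    and inj: "\<And>v. (\<And>i. i \<notin> I \<Longrightarrow> v $ i = 0) \<Longrightarrow> \<Phi> *v v = 0 \<Longrightarrow> v = 0"
  shows "bp_recovers \<Phi> (\<Phi> *v x) x"
proof -
  have le1: "\<bar>column i \<Phi> \<bullet> u\<bar> \<le> 1" for i
    using on[of i] off(2)[of i] by (cases "i \<in> I") (auto simp: sgn_real_def)
  have term_le: "z $ i * (column i \<Phi> \<bullet> u) \<le> \<bar>z $ i\<bar>" for i z
  proof -
    have "z $ i * (column i \<Phi> \<bullet> u) \<le> \<bar>z $ i\<bar> * \<bar>column i \<Phi> \<bullet> u\<bar>" by (simp add: abs_mult[symmetric])
    also have "\<dots> \<le> \<bar>z $ i\<bar> * 1" by (intro mult_left_mono le1) simp
    finally show ?thesis by simp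
  qed
  have lower: "(\<Phi> *v z) \<bullet> u \<le> l1_norm z" for z
    unfolding matrix_vector_inner l1_norm_def by (intro sum_mono term_le)
  have x: "l1_norm x = (\<Phi> *v x) \<bullet> u"
    unfolding matrix_vector_inner l1_norm_def
  proof (rule sum.cong[OF refl])
    fix i show "\<bar>x $ i\<bar> = x $ i * (column i \<Phi> \<bullet> u)"
      using on[of i] off(1)[of i] by (cases "i \<in> I") (auto simp: abs_sgn mult.commute)
  qed
  have uniq: "z = x" if z: "\<Phi> *v z = \<Phi> *v x" and le: "l1_norm z \<le> l1_norm x" for z
  proof -
    have "(\<Sum>i\<in>UNIV. \<bar>z $ i\<bar> - z $ i * (column i \<Phi> \<bullet> u)) = 0"
      using lower[of z] le x z by (simp add: sum_subtractf matrix_vector_inner[symmetric] l1_norm_def)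
    then have eq: "\<bar>z $ i\<bar> = z $ i * (column i \<Phi> \<bullet> u)" for i
      using term_le[of z] by (subst (asm) sum_nonneg_eq_0_iff) auto
    have "z $ i = 0" if "i \<notin> I" for i
    proof (rule ccontr)
      assume nz: "z $ i \<noteq> 0"
      have "\<bar>z $ i\<bar> = \<bar>z $ i\<bar> * \<bar>column i \<Phi> \<bullet> u\<bar>" using eq[of i] by (metis abs_abs abs_mult)
      then show False using nz off(2)[OF that] by simp
    qed
    then have "z - x = 0" using z off(1) by (intro inj) (auto simp: matrix_vector_mult_diff_distrib)
    then show ?thesis by simp
  qed
  have "is_arg_min l1_norm (\<lambda>z. \<Phi> *v z = \<Phi> *v x) w \<longleftrightarrow> w = x" for w
  proof
    assume "is_arg_min l1_norm (\<lambda>z. \<Phi> *v z = \<Phi> *v x) w"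
    then have "\<Phi> *v w = \<Phi> *v x" "l1_norm w \<le> l1_norm x" by (auto simp: is_arg_min_def not_less)
    then show "w = x" by (rule uniq)
  next
    assume "w = x"
    have "\<not> l1_norm z < l1_norm x" if "\<Phi> *v z = \<Phi> *v x" for z
      using lower[of z] x that by simp
    then show "is_arg_min l1_norm (\<lambda>z. \<Phi> *v z = \<Phi> *v x) w" using \<open>w = x\<close> by (auto simp: is_arg_min_def)
  qed
  then show ?thesis by (simp add: bp_recovers_def basis_pursuit_def)
qed

section \<open>The certificate built from the hollow Gram matrix\<close>

lemma transpose_hollow_gram: "transpose (hollow_gram \<Phi>) = hollow_gram \<Phi>"
  by (simp add: hollow_gram_def vec_eq_iff transpose_def matrix_matrix_mult_def mat_def mult.commute)

lemma hollow_gram_nth: "hollow_gram \<Phi> $ i $ j = column i \<Phi> \<bullet> column j \<Phi> - (if i = j then 1 else 0)"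
  by (simp add: hollow_gram_def matrix_matrix_mult_def transpose_def mat_def column_def inner_vec_def)

lemma column_inner_mult:
  fixes \<Phi> :: "real^'k^'d"
  shows "column j \<Phi> \<bullet> (\<Phi> *v z) = z $ j + hollow_gram \<Phi> $ j \<bullet> z"
proof -
  have "column j \<Phi> \<bullet> (\<Phi> *v z) = (\<Sum>i\<in>UNIV. z $ i * (column i \<Phi> \<bullet> column j \<Phi>))"
    by (subst inner_commute) (rule matrix_vector_inner)
  also have "\<dots> = (\<Sum>i\<in>UNIV. hollow_gram \<Phi> $ j $ i * z $ i) + (\<Sum>i\<in>UNIV. if j = i then z $ i else 0)"
    unfolding sum.distrib[symmetric] hollow_gram_nth
    by (intro sum.cong refl) (simp add: inner_commute algebra_simps)
  finally show ?thesis by (simp add: inner_vec_def)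
qed

text \<open>Since the perturbation at most halves a vector,
  \<open>norm v \<le> 2 * norm (T v)\<close>; so \<open>T\<close> is injective, hence onto in finite
  dimension.\<close>

lemma perturbed_identity_inverse:
  fixes H :: "real^'k^'k"
  assumes "sub_norm H I I \<le> 1 / 2"
  obtains G where "\<And>v. G v + rst I (H *v rst I (G v)) = v" "\<And>v. norm (G v) \<le> 2 * norm v"
proof -
  define T where "T v = v + rst I (H *v rst I v)" for v
  have lin: "linear T" unfolding T_def[abs_def] by (intro linear_compose_add linear_sub linear_ident)
  have lower: "norm v \<le> 2 * norm (T v)" for v
  proof -
    have "norm (rst I (H *v rst I v)) \<le> sub_norm H I I * norm v" by (rule sub_norm_bound)
    also have "\<dots> \<le> 1 / 2 * norm v" by (intro mult_right_mono assms) simp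
    finally have "norm (rst I (H *v rst I v)) \<le> norm v / 2" by simp
    moreover have "norm v \<le> norm (T v) + norm (rst I (H *v rst I v))"
      using norm_triangle_ineq4[of "T v" "rst I (H *v rst I v)"] by (simp add: T_def)
    ultimately show ?thesis by simp
  qed
  have "inj T"
    unfolding linear_injective_0[OF lin]
  proof (intro allI impI)
    fix v assume "T v = 0"
    then show "v = 0" using lower[of v] by simp
  qed
  then have "surj T" by (rule linear_inj_imp_surj[OF lin])
  then have "T (inv T v) = v" for v by (rule surj_f_inv_f)
  moreover then have "norm (inv T v) \<le> 2 * norm v" for v using lower[of "inv T v"] by simp
  ultimately show ?thesis using that[of "inv T"] by (simp add: T_def)
qed

text \<open>The vectors \<open>b j\<close> are fixed before the signs. Applying the inverse of the
  perturbed identity to the restricted rows instead of to the sign vector \<open>s\<close> is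
  possible by symmetry and makes the off-support correlations linear in \<open>s\<close>.\<close>

lemma bp_recovers_if_correlations_small:
  fixes \<Phi> :: "real^'k^'d"
  defines "H \<equiv> hollow_gram \<Phi>"
  assumes N: "sub_norm H I I \<le> 1 / 2"
  shows "\<exists>b. (\<forall>j. norm (b j) \<le> 2 * norm (rst I (H $ j))) \<and>
    (\<forall>x. (\<forall>i. x $ i \<noteq> 0 \<longleftrightarrow> i \<in> I) \<longrightarrow> (\<forall>j. \<bar>b j \<bullet> (\<chi> i. sgn (x $ i))\<bar> < 1)
       \<longrightarrow> bp_recovers \<Phi> (\<Phi> *v x) x)"
proof -
  obtain G where G: "\<And>v. G v + rst I (H *v rst I (G v)) = v" "\<And>v. norm (G v) \<le> 2 * norm v"
    using perturbed_identity_inverse[OF N] by blast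
  have sym: "transpose H = H" unfolding H_def by (rule transpose_hollow_gram)
  have rowH: "H $ j \<bullet> v = (H *v v) $ j" for j v
    by (simp add: matrix_vector_mult_def inner_vec_def)
  define b where "b j = G (rst I (H $ j))" for j
  have "bp_recovers \<Phi> (\<Phi> *v x) x"
    if supp: "\<And>i. x $ i \<noteq> 0 \<longleftrightarrow> i \<in> I" and small: "\<And>j. \<bar>b j \<bullet> (\<chi> i. sgn (x $ i))\<bar> < 1" for x
  proof -
    define s :: "real^'k" where "s = (\<chi> i. sgn (x $ i))"
    define z where "z = G s"
    have Tz: "z + rst I (H *v rst I z) = s" unfolding z_def by (rule G)
    \<comment> \<open>Outside \<open>I\<close> the perturbed identity acts as the identity and
      \<open>s\<close> vanishes, so \<open>z\<close> vanishes there too.\<close>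
    have zI: "rst I z = z"
    proof -
      have "z $ i = 0" if "i \<notin> I" for i
        using arg_cong[OF Tz, of "\<lambda>w. w $ i"] supp[of i] that by (simp add: s_def)
      then show ?thesis by (auto simp: vec_eq_iff)
    qed
    show ?thesis
    proof (rule bp_recovers_certificate[of I _ "\<Phi> *v z"])
      fix i assume i: "i \<in> I"
      have "z $ i + (H *v z) $ i = s $ i"
        using arg_cong[OF Tz, of "\<lambda>w. w $ i"] i by (simp add: zI)
      then show "column i \<Phi> \<bullet> (\<Phi> *v z) = sgn (x $ i)"
        by (simp add: column_inner_mult rowH[unfolded H_def] H_def s_def)
    next
      fix i assume i: "i \<notin> I"
      then show "x $ i = 0" using supp by blast
      have "z $ i = 0" using i arg_cong[OF zI, of "\<lambda>w. w $ i"] by simp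
      then have "column i \<Phi> \<bullet> (\<Phi> *v z) = H $ i \<bullet> rst I z"
        by (simp add: column_inner_mult zI H_def)
      also have "\<dots> = (b i + rst I (H *v rst I (b i))) \<bullet> z"
        unfolding b_def G by (simp only: rst_inner)
      also have "\<dots> = b i \<bullet> (z + rst I (H *v rst I z))"
        by (simp only: inner_add_left inner_add_right rst_inner symmetric_matrix_inner[OF sym])
      also have "\<dots> = b i \<bullet> s" unfolding Tz ..
      finally show "\<bar>column i \<Phi> \<bullet> (\<Phi> *v z)\<bar> < 1" using small[of i] by (simp add: s_def)
    next
      \<comment> \<open>A kernel vector supported on \<open>I\<close> satisfies
        \<open>v = - (H *v v)\<close>, so its norm is at most half of itself.\<close>
      fix v assume v: "\<And>i. i \<notin> I \<Longrightarrow> v $ i = 0" and Phi: "\<Phi> *v v = 0"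
      have vI: "rst I v = v" using v by (auto simp: vec_eq_iff)
      have "v $ j + (H *v v) $ j = 0" for j
        using column_inner_mult[of j \<Phi> v] Phi by (simp add: rowH[unfolded H_def] H_def)
      then have "v = - (H *v v)" by (simp add: vec_eq_iff add_eq_0_iff2)
      then have "norm v = norm (rst I (H *v rst I v))"
        using vI by (metis linear_neg[OF linear_rst] norm_minus_cancel)
      also have "\<dots> \<le> sub_norm H I I * norm v" by (rule sub_norm_bound)
      also have "\<dots> \<le> 1 / 2 * norm v" by (intro mult_right_mono N) simp
      finally show "v = 0" by simp
    qed
  qed
  moreover have "norm (b j) \<le> 2 * norm (rst I (H $ j))" for j unfolding b_def by (rule G)
  ultimately show ?thesis by (intro exI[of _ b]) simp
qed

section \<open>Random signs\<close>

text \<open>Hoeffding's inequality, where the squared ranges add up to four times the sum of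
  squares. Vanishing coefficients are split off to keep the denominator positive.\<close>

lemma rademacher_tail:
  assumes v: "(\<Sum>k=1..S. (a k)\<^sup>2) \<le> v" "0 < v"
  shows "measure_pmf.prob (rademacher_signs S) {\<sigma>. 1 \<le> \<bar>\<Sum>k=1..S. a k * \<sigma> k\<bar>} \<le> 2 * exp (- 1 / (2 * v))"
proof (cases "(\<Sum>k=1..S. (a k)\<^sup>2) = 0")
  case True
  then have "a k = 0" if "k \<in> {1..S}" for k
    using that by (subst (asm) sum_nonneg_eq_0_iff) auto
  then have "(\<Sum>k=1..S. a k * \<sigma> k) = 0" for \<sigma> by (intro sum.neutral) simp
  then show ?thesis by simp
next
  case False
  then have pos: "0 < (\<Sum>k=1..S. (a k)\<^sup>2)" using sum_nonneg[of "{1..S}" "\<lambda>k. (a k)\<^sup>2"] by simp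
  let ?M = "measure_pmf (rademacher_signs S)"
  have comp: "map_pmf (\<lambda>f. f k) (rademacher_signs S) = pmf_of_set {-1, 1}" if "k \<in> {1..S}" for k
    unfolding rademacher_signs_def using that by (simp add: Pi_pmf_component)
  have indep: "prob_space.indep_vars ?M (\<lambda>_. count_space UNIV) (\<lambda>k \<sigma>. \<sigma> k) {1..S}"
    unfolding rademacher_signs_def by (rule indep_vars_Pi_pmf[OF finite_atLeastAtMost])
  interpret Hoeffding_ineq ?M "{1..S}" "\<lambda>k \<sigma>. a k * \<sigma> k" "\<lambda>k. - \<bar>a k\<bar>" "\<lambda>k. \<bar>a k\<bar>" 0
  proof unfold_locales
    show "finite {1..S}" by simp
    show "prob_space.indep_vars ?M (\<lambda>_. borel) (\<lambda>k \<sigma>. a k * \<sigma> k) {1..S}"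
      using prob_space.indep_vars_compose2[OF prob_space_measure_pmf indep, of "\<lambda>k y. a k * y" "\<lambda>_. borel"] by simp
    show "AE \<sigma> in ?M. a k * \<sigma> k \<in> {- \<bar>a k\<bar>..\<bar>a k\<bar>}" if k: "k \<in> {1..S}" for k
    proof (rule AE_pmfI)
      fix \<sigma> assume "\<sigma> \<in> set_pmf (rademacher_signs S)"
      then have "\<sigma> k \<in> set_pmf (map_pmf (\<lambda>f. f k) (rademacher_signs S))" by simp
      then have "\<sigma> k = -1 \<or> \<sigma> k = 1" unfolding comp[OF k] by simp
      then show "a k * \<sigma> k \<in> {- \<bar>a k\<bar>..\<bar>a k\<bar>}" by auto
    qed
    have "(\<integral>\<sigma>. a k * \<sigma> k \<partial>?M) = 0" if k: "k \<in> {1..S}" for k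
    proof -
      have "(\<integral>\<sigma>. a k * \<sigma> k \<partial>?M) = (\<integral>y. a k * y \<partial>measure_pmf (map_pmf (\<lambda>f. f k) (rademacher_signs S)))"
        by simp
      also have "\<dots> = 0" unfolding comp[OF k] by (simp add: integral_pmf_of_set)
      finally show ?thesis .
    qed
    then have "(\<Sum>k\<in>{1..S}. measure_pmf.expectation (rademacher_signs S) (\<lambda>\<sigma>. a k * \<sigma> k)) = 0"
      by (intro sum.neutral ballI)
    then show "0 \<equiv> \<Sum>k\<in>{1..S}. measure_pmf.expectation (rademacher_signs S) (\<lambda>\<sigma>. a k * \<sigma> k)"
      by (intro eq_reflection) (rule sym)
  qed
  have sq: "(\<Sum>k\<in>{1..S}. (\<bar>a k\<bar> - - \<bar>a k\<bar>)\<^sup>2) = 4 * (\<Sum>k=1..S. (a k)\<^sup>2)"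
    by (simp add: sum_distrib_left power2_eq_square)
  have "measure_pmf.prob (rademacher_signs S) {\<sigma>. 1 \<le> \<bar>\<Sum>k=1..S. a k * \<sigma> k\<bar>} \<le> 2 * exp (- 2 * 1\<^sup>2 / (4 * (\<Sum>k=1..S. (a k)\<^sup>2)))"
    using Hoeffding_ineq_abs_ge[of 1] pos unfolding sq by simp
  also have "- 2 * 1\<^sup>2 / (4 * (\<Sum>k=1..S. (a k)\<^sup>2)) = - (1 / (2 * (\<Sum>k=1..S. (a k)\<^sup>2)))" by simp
  also have "2 * exp (- (1 / (2 * (\<Sum>k=1..S. (a k)\<^sup>2)))) \<le> 2 * exp (- 1 / (2 * v))"
    using v pos by (simp add: frac_le)
  finally show ?thesis .
qed

section \<open>Recovery under the random signal model\<close>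

lemma PE_eq_sum_pmf:
  assumes "\<And>i. 0 \<le> p i" "\<And>i. p i \<le> 1"
  shows "PE p UNIV f = (\<Sum>I\<in>UNIV. pmf (poisson_sampling p) I * f I)"
  by (simp add: PE_def pmf_poisson_sampling[OF assms] Compl_eq_Diff_UNIV)

text \<open>Conditional probabilities multiplied by the probability of the conditioning event, which
  is positive by \<open>poisson_sampling_card_possible\<close>.\<close>

lemma prob_rejective_sampling:
  assumes p: "\<And>i. 0 \<le> p i" "\<And>i. p i \<le> 1" and S: "(\<Sum>i\<in>UNIV. p i) = real S"
  shows "card_mass p UNIV (int S) * measure_pmf.prob (rejective_sampling p S) B
    = PE_card p UNIV (\<lambda>I. of_bool (I \<in> B)) (int S)" and "0 < card_mass p UNIV (int S)"
proof -
  let ?P = "poisson_sampling p" and ?C = "{I. card I = S}"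
  have ne: "set_pmf ?P \<inter> ?C \<noteq> {}" by (rule poisson_sampling_card_possible[OF p S])
  have mass: "card_mass p UNIV (int S) = measure_pmf.prob ?P ?C"
    unfolding PE_card_def PE_eq_sum_pmf[OF p]
    by (subst measure_measure_pmf_finite) (auto simp: if_distrib sum.If_cases cong: if_cong)
  show pos: "0 < card_mass p UNIV (int S)"
    unfolding mass using ne by (meson disjoint_iff measure_pmf_posI)
  have "measure_pmf.prob (rejective_sampling p S) B = (\<Sum>I\<in>B. pmf (rejective_sampling p S) I)"
    by (rule measure_measure_pmf_finite) simp
  also have "\<dots> = (\<Sum>I\<in>B. (if card I = S then pmf ?P I else 0) / card_mass p UNIV (int S))"
    unfolding rejective_sampling_def mass by (intro sum.cong refl) (simp add: pmf_cond[OF ne])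
  also have "\<dots> = (\<Sum>I\<in>B. if card I = S then pmf ?P I else 0) / card_mass p UNIV (int S)"
    by (rule sum_divide_distrib[symmetric])
  also have "(\<Sum>I\<in>B. if card I = S then pmf ?P I else 0)
    = (\<Sum>I\<in>UNIV. pmf ?P I * (if int (card I) = int S then of_bool (I \<in> B) else 0))"
    by (intro sum.mono_neutral_cong_left) auto
  also have "\<dots> = PE_card p UNIV (\<lambda>I. of_bool (I \<in> B)) (int S)"
    unfolding PE_card_def PE_eq_sum_pmf[OF p] ..
  finally show "card_mass p UNIV (int S) * measure_pmf.prob (rejective_sampling p S) B
    = PE_card p UNIV (\<lambda>I. of_bool (I \<in> B)) (int S)"
    using pos by simp
qed

lemma rejective_prob_le:
  assumes p: "\<And>i. 0 \<le> p i" "\<And>i. p i \<le> 1" and S: "(\<Sum>i\<in>UNIV. p i) = real S"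
    and up: "\<And>I J. I \<in> B \<Longrightarrow> I \<subseteq> J \<Longrightarrow> J \<in> B"
  shows "measure_pmf.prob (rejective_sampling p S) B \<le> 10 * PE p UNIV (\<lambda>I. of_bool (I \<in> B))"
proof -
  let ?m = "card_mass p UNIV (int S)"
  have "?m * measure_pmf.prob (rejective_sampling p S) B = PE_card p UNIV (\<lambda>I. of_bool (I \<in> B)) (int S)"
    by (rule prob_rejective_sampling[OF p S])
  also have "\<dots> \<le> 10 * (?m * PE p UNIV (\<lambda>I. of_bool (I \<in> B)))"
    using up by (intro PE_card_le_PE p S of_bool_mono) auto
  finally have "?m * measure_pmf.prob (rejective_sampling p S) B \<le> ?m * (10 * PE p UNIV (\<lambda>I. of_bool (I \<in> B)))"
    by simp
  then show ?thesis by (rule mult_left_le_imp_le) (rule prob_rejective_sampling(2)[OF p S])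
qed

text \<open>Integrate over the second component first. The bound on \<open>Q\<close> is asked only
  on the support of \<open>R\<close>, since an enumeration is available only for sets of cardinality
  \<open>S\<close>.\<close>

lemma prob_pair_pmf_le:
  assumes "\<And>a. a \<in> set_pmf R \<Longrightarrow> a \<notin> B \<Longrightarrow> measure_pmf.prob Q {b. P a b} \<le> \<delta>" "0 \<le> \<delta>"
  shows "measure_pmf.prob (pair_pmf R Q) {(a, b). P a b} \<le> measure_pmf.prob R B + \<delta>"
proof -
  have "emeasure (pair_pmf R Q) {(a, b). P a b} = (\<integral>\<^sup>+x. indicator {(a, b). P a b} x \<partial>pair_pmf R Q)" by simp
  also have "\<dots> = (\<integral>\<^sup>+a. \<integral>\<^sup>+b. indicator {b. P a b} b \<partial>Q \<partial>R)"
    unfolding nn_integral_pair_pmf' by (intro nn_integral_cong) (simp add: indicator_def)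
  also have "\<dots> = (\<integral>\<^sup>+a. emeasure Q {b. P a b} \<partial>R)" by simp
  also have "\<dots> \<le> (\<integral>\<^sup>+a. indicator B a + ennreal \<delta> \<partial>R)"
  proof (rule nn_integral_mono_AE, rule AE_pmfI)
    fix a assume a: "a \<in> set_pmf R"
    show "emeasure Q {b. P a b} \<le> indicator B a + ennreal \<delta>"
    proof (cases "a \<in> B")
      case True
      have "emeasure Q {b. P a b} \<le> 1" by (rule measure_pmf.emeasure_le_1)
      then show ?thesis using True by (simp add: add_increasing2)
    next
      case False
      then show ?thesis using assms(1)[OF a False]
        by (simp add: measure_pmf.emeasure_eq_measure ennreal_leI)
    qed
  qed
  also have "\<dots> = emeasure R B + ennreal \<delta>"
    by (subst nn_integral_add) (simp_all add: measure_pmf.emeasure_space_1[simplified])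
  finally have "ennreal (measure_pmf.prob (pair_pmf R Q) {(a, b). P a b}) \<le> ennreal (measure_pmf.prob R B + \<delta>)"
    using assms(2) by (simp add: measure_pmf.emeasure_eq_measure ennreal_plus)
  then show ?thesis using assms(2) by (simp add: ennreal_le_iff del: ennreal_plus)
qed

lemma coefficients_nth:
  assumes "inj_on \<iota> {1..S}" "k \<in> {1..S}"
  shows "coefficients S c \<sigma> \<iota> $ \<iota> k = c k * \<sigma> k"
proof -
  have "coefficients S c \<sigma> \<iota> $ \<iota> k = (\<Sum>l\<in>{1..S}. if l = k then c l * \<sigma> l else 0)"
    unfolding coefficients_def sum_component
  proof (rule sum.cong[OF refl])
    fix l assume "l \<in> {1..S}"
    then have "\<iota> l = \<iota> k \<longleftrightarrow> l = k" using assms by (metis inj_on_eq_iff)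
    then show "axis (\<iota> l) (c l * \<sigma> l) $ \<iota> k = (if l = k then c l * \<sigma> l else 0)"
      by (auto simp: axis_def)
  qed
  then show ?thesis using assms(2) by simp
qed

lemma coefficients_outside: "i \<notin> \<iota> ` {1..S} \<Longrightarrow> coefficients S c \<sigma> \<iota> $ i = 0"
  unfolding coefficients_def sum_component by (intro sum.neutral) (auto simp: axis_def)

lemma set_rademacher_signs: "\<sigma> \<in> set_pmf (rademacher_signs S) \<Longrightarrow> k \<in> {1..S} \<Longrightarrow> \<sigma> k = 1 \<or> \<sigma> k = -1"
  by (auto simp: rademacher_signs_def set_Pi_pmf PiE_dflt_def)

text \<open>A union bound over \<open>j\<close>: the squared length of \<open>b j\<close> is at most
  \<open>4 / (16 * L) = 1 / (4 * L)\<close>, so each Rademacher sum reaches 1 in absolute value with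
  probability at most \<open>2 * exp (- 2 * L)\<close>.\<close>

lemma bp_failure_prob_le:
  fixes \<Phi> :: "real^'k^'d"
  assumes N: "sub_norm (hollow_gram \<Phi>) I I \<le> 1 / 2"
    and r: "\<And>j. (\<Sum>i\<in>I. (hollow_gram \<Phi> $ j $ i)\<^sup>2) \<le> 1 / (16 * L)" and L: "0 < L"
    and c: "\<And>k. k \<in> {1..S} \<Longrightarrow> c k > 0" and \<iota>: "bij_betw \<iota> {1..S} I"
  shows "measure_pmf.prob (rademacher_signs S)
      {\<sigma>. \<not> bp_recovers \<Phi> (signal \<Phi> S c \<sigma> \<iota>) (coefficients S c \<sigma> \<iota>)} \<le> 2 * real CARD('k) * exp (- 2 * L)"
proof -
  let ?Q = "rademacher_signs S"
  obtain b where b: "\<forall>j. norm (b j) \<le> 2 * norm (rst I (hollow_gram \<Phi> $ j))"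
    and rec: "\<forall>x. (\<forall>i. x $ i \<noteq> 0 \<longleftrightarrow> i \<in> I) \<longrightarrow> (\<forall>j. \<bar>b j \<bullet> (\<chi> i. sgn (x $ i))\<bar> < 1)
       \<longrightarrow> bp_recovers \<Phi> (\<Phi> *v x) x"
    using bp_recovers_if_correlations_small[OF N] by (elim exE conjE)
  have inj: "inj_on \<iota> {1..S}" and img: "\<iota> ` {1..S} = I" using \<iota> by (auto simp: bij_betw_def)
  let ?A = "\<lambda>j. {\<sigma>. 1 \<le> \<bar>\<Sum>k=1..S. b j $ \<iota> k * \<sigma> k\<bar>}"
  have "measure_pmf.prob ?Q {\<sigma>. \<not> bp_recovers \<Phi> (signal \<Phi> S c \<sigma> \<iota>) (coefficients S c \<sigma> \<iota>)}
    \<le> measure_pmf.prob ?Q (\<Union>j\<in>UNIV. ?A j)"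
  proof (rule measure_pmf.finite_measure_mono_AE, rule AE_pmfI, rule impI)
    fix \<sigma> assume \<sigma>: "\<sigma> \<in> set_pmf ?Q"
      and fail: "\<sigma> \<in> {\<sigma>. \<not> bp_recovers \<Phi> (signal \<Phi> S c \<sigma> \<iota>) (coefficients S c \<sigma> \<iota>)}"
    let ?x = "coefficients S c \<sigma> \<iota>"
    \<comment> \<open>Because the \<open>c k\<close> are positive, the sign of each entry is the
      Rademacher sign.\<close>
    have on: "?x $ \<iota> k \<noteq> 0" "sgn (?x $ \<iota> k) = \<sigma> k" if k: "k \<in> {1..S}" for k
      using set_rademacher_signs[OF \<sigma> k] c[OF k] unfolding coefficients_nth[OF inj k] by (auto simp: sgn_mult)
    have supp: "?x $ i \<noteq> 0 \<longleftrightarrow> i \<in> I" for i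
      using on coefficients_outside[of i \<iota> S c \<sigma>] img by blast
    have corr: "b j \<bullet> (\<chi> i. sgn (?x $ i)) = (\<Sum>k=1..S. b j $ \<iota> k * \<sigma> k)" for j
    proof -
      have "b j \<bullet> (\<chi> i. sgn (?x $ i)) = (\<Sum>i\<in>UNIV. b j $ i * sgn (?x $ i))"
        by (simp only: inner_vec_def inner_real_def vec_lambda_beta)
      also have "\<dots> = (\<Sum>i\<in>I. b j $ i * sgn (?x $ i))"
      proof (rule sum.mono_neutral_right)
        show "\<forall>i\<in>UNIV - I. b j $ i * sgn (?x $ i) = 0"
        proof
          fix i assume "i \<in> UNIV - I"
          then have "?x $ i = 0" using supp[of i] by blast
          then show "b j $ i * sgn (?x $ i) = 0" by (simp only: sgn_zero mult_zero_right)
        qed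
      qed simp_all
      also have "\<dots> = (\<Sum>k=1..S. b j $ \<iota> k * sgn (?x $ \<iota> k))"
        by (rule sum.reindex_cong[OF inj img[symmetric] refl])
      also have "\<dots> = (\<Sum>k=1..S. b j $ \<iota> k * \<sigma> k)" by (intro sum.cong refl arg_cong2[where f = times] on(2))
      finally show ?thesis .
    qed
    show "\<sigma> \<in> (\<Union>j\<in>UNIV. ?A j)"
    proof (rule ccontr)
      assume "\<sigma> \<notin> (\<Union>j\<in>UNIV. ?A j)"
      then have "\<bar>b j \<bullet> (\<chi> i. sgn (?x $ i))\<bar> < 1" for j
        unfolding corr by (simp only: UN_iff mem_Collect_eq not_le bex_UNIV not_ex)
      from rec[rule_format, OF supp this] fail show False
        by (simp only: signal_eq_coefficients mem_Collect_eq not_True_eq_False)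
    qed
  qed simp
  also have "\<dots> \<le> (\<Sum>j\<in>UNIV. measure_pmf.prob ?Q (?A j))"
    by (rule measure_pmf.finite_measure_subadditive_finite) auto
  also have "\<dots> \<le> (\<Sum>j\<in>(UNIV::'k set). 2 * exp (- 2 * L))"
  proof (rule sum_mono)
    fix j
    have "(\<Sum>k=1..S. (b j $ \<iota> k)\<^sup>2) = (\<Sum>i\<in>I. (b j $ i)\<^sup>2)"
      by (rule sum.reindex_cong[OF inj img[symmetric] refl, symmetric])
    also have "\<dots> \<le> (norm (b j))\<^sup>2" unfolding norm_sq_sum by (intro sum_mono2) auto
    also have "\<dots> \<le> (2 * norm (rst I (hollow_gram \<Phi> $ j)))\<^sup>2" by (intro power_mono b[rule_format]) simp
    also have "\<dots> \<le> 4 * (1 / (16 * L))" using r[of j] by (simp add: power_mult_distrib norm_rst_sq)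
    finally have "(\<Sum>k=1..S. (b j $ \<iota> k)\<^sup>2) \<le> 1 / (4 * L)" by simp
    from rademacher_tail[OF this] L
    show "measure_pmf.prob ?Q (?A j) \<le> 2 * exp (- 2 * L)" by simp
  qed
  also have "\<dots> = 2 * real CARD('k) * exp (- 2 * L)" by simp
  finally show ?thesis .
qed

lemma weight_matrix_mult: "weight_matrix p *v x = wt p x"
  by (simp add: vec_eq_iff matrix_vector_mult_def weight_matrix_def if_distrib[of "\<lambda>u. u * _"] cong: if_cong)

lemma mult_weight_matrix_nth: "(H ** weight_matrix p) $ j $ i = H $ j $ i * sqrt (p i)"
  by (simp add: matrix_matrix_mult_def weight_matrix_def if_distrib cong: if_cong)

lemma hollow_sampling_hollow_gram:
  fixes \<Phi> :: "real^'k^'d"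
  assumes unit: "\<And>i. norm (column i \<Phi>) = 1" and p: "\<And>i. 0 \<le> p i" "\<And>i. p i \<le> 1" and L: "1 \<le> L"
    and WHW: "spectral_norm (weight_matrix p ** hollow_gram \<Phi> ** weight_matrix p) \<le> 1 / (4 * (exp 1)\<^sup>2)"
    and coh: "coherence \<Phi> \<le> 1 / (4 * L)"
    and HW: "(max_row_norm (hollow_gram \<Phi> ** weight_matrix p))\<^sup>2 \<le> 1 / (16 * (exp 1)\<^sup>2 * L)"
  shows "hollow_sampling (hollow_gram \<Phi>) p L"
proof
  let ?H = "hollow_gram \<Phi>" and ?W = "weight_matrix p"
  have e: "(exp 1)\<^sup>2 = exp (2::real)" by (simp add: exp_double[symmetric])
  show "transpose ?H = ?H" by (rule transpose_hollow_gram)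
  show diag: "?H $ i $ i = 0" for i using unit[of i] by (simp add: hollow_gram_nth norm_eq_1)
  show "0 \<le> p i" "p i \<le> 1" "1 \<le> L" for i using p L by auto
  show "(?H $ i $ j)\<^sup>2 \<le> 1 / (16 * L\<^sup>2)" for i j
  proof (cases "i = j")
    case False
    have "finite {\<bar>column i \<Phi> \<bullet> column j \<Phi>\<bar> | i j. i \<noteq> j}"
      by (rule finite_subset[of _ "range (\<lambda>(i, j). \<bar>column i \<Phi> \<bullet> column j \<Phi>\<bar>)"]) auto
    then have "\<bar>column i \<Phi> \<bullet> column j \<Phi>\<bar> \<le> coherence \<Phi>"
      unfolding coherence_def using False by (intro Max_ge) auto
    then have "\<bar>?H $ i $ j\<bar> \<le> 1 / (4 * L)" using coh False by (simp add: hollow_gram_nth)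
    then have "\<bar>?H $ i $ j\<bar>\<^sup>2 \<le> (1 / (4 * L))\<^sup>2" by (intro power_mono) auto
    then show ?thesis by (simp add: power_divide power_mult_distrib)
  qed (simp add: diag)
  show "(\<Sum>i\<in>UNIV. p i * (?H $ j $ i)\<^sup>2) \<le> 1 / (16 * exp 2 * L)" for j
  proof -
    have "norm (row j (?H ** ?W)) \<le> max_row_norm (?H ** ?W)" unfolding max_row_norm_def by (intro Max_ge) auto
    then have "(norm (row j (?H ** ?W)))\<^sup>2 \<le> (max_row_norm (?H ** ?W))\<^sup>2" by (intro power_mono) auto
    moreover have "(norm (row j (?H ** ?W)))\<^sup>2 = (\<Sum>i\<in>UNIV. p i * (?H $ j $ i)\<^sup>2)"
      unfolding norm_sq_sum by (simp add: row_def mult_weight_matrix_nth power_mult_distrib p mult.commute)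
    ultimately show ?thesis using HW by (simp add: e)
  qed
  show "(norm (wt p (?H *v wt p x)))\<^sup>2 \<le> (norm x)\<^sup>2 / (16 * (exp 2)\<^sup>2)" for x
  proof -
    have "wt p (?H *v wt p x) = (?W ** ?H ** ?W) *v x"
      by (simp add: weight_matrix_mult[symmetric] matrix_vector_mul_assoc matrix_mul_assoc)
    then have "norm (wt p (?H *v wt p x)) \<le> spectral_norm (?W ** ?H ** ?W) * norm x"
      unfolding spectral_norm_def using onorm[OF matrix_vector_mul_bounded_linear] by simp
    also have "\<dots> \<le> 1 / (4 * exp 2) * norm x" using WHW by (intro mult_right_mono) (auto simp: e)
    finally have "(norm (wt p (?H *v wt p x)))\<^sup>2 \<le> (1 / (4 * exp 2) * norm x)\<^sup>2" by (intro power_mono) auto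
    then show ?thesis by (simp add: power_divide power_mult_distrib)
  qed
qed

theorem theorem13:
  fixes \<Phi> :: "real^'k^'d" and p :: "'k \<Rightarrow> real" and S :: nat and c :: "nat \<Rightarrow> real"
    and \<iota> :: "'k set \<Rightarrow> nat \<Rightarrow> 'k" and \<epsilon> :: real
  defines "H \<equiv> hollow_gram \<Phi>" and "\<mu> \<equiv> coherence \<Phi>" and "W \<equiv> weight_matrix p"
    and "K \<equiv> real CARD('k)"
  assumes unit_columns: "\<And>i. norm (column i \<Phi>) = 1"
    and p_ge_0: "\<And>i. 0 \<le> p i" and p_le_1: "\<And>i. p i \<le> 1"
    and S_pos: "S > 0" and sum_p: "(\<Sum>i\<in>UNIV. p i) = real S"
    and c_pos: "\<And>k. k \<in> {1..S} \<Longrightarrow> c k > 0"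
    and enum: "\<And>I. card I = S \<Longrightarrow> bij_betw (\<iota> I) {1..S} I"
    and eps: "0 < \<epsilon>" "\<epsilon> < 1"
    and WHW: "spectral_norm (W ** H ** W) \<le> 1 / (4 * (exp 1)\<^sup>2)"
    and coh: "\<mu> \<le> 1 / (4 * ln (220 * K / \<epsilon>))"
    and HW: "(max_row_norm (H ** W))\<^sup>2 \<le> 1 / (16 * (exp 1)\<^sup>2 * ln (220 * K / \<epsilon>))"
  shows "measure_pmf.prob (signal_model p S)
           {(I, \<sigma>). bp_recovers \<Phi> (signal \<Phi> S c \<sigma> (\<iota> I)) (coefficients S c \<sigma> (\<iota> I))}
         \<ge> 1 - \<epsilon>"
proof -
  define L where "L = ln (220 * K / \<epsilon>)"
  have K1: "1 \<le> K" unfolding K_def by simp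
  then have big: "220 \<le> 220 * K / \<epsilon>" using eps by (simp add: field_simps)
  have "exp 1 \<le> 220 * K / \<epsilon>" using e_less_272 big by simp
  then have L1: "1 \<le> L" unfolding L_def using big by (subst ln_ge_iff) auto
  have eL: "exp (- L) = \<epsilon> / (220 * K)"
    unfolding L_def exp_minus using big by (subst exp_ln) auto
  interpret hollow_sampling H p L
    unfolding H_def
    by (rule hollow_sampling_hollow_gram)
      (use unit_columns p_ge_0 p_le_1 L1 WHW coh HW in \<open>simp_all only: L_def H_def W_def \<mu>_def\<close>)
  \<comment> \<open>Bad supports: those where the inverse need not be bounded by 2 or a restricted
    row is too long. Both defects persist in larger sets, as \<open>rejective_prob_le\<close>
    requires.\<close>
  define B where "B = {I. 1 / 2 < sub_norm H I I} \<union> (\<Union>j. {I. 1 / (16 * L) < (\<Sum>i\<in>I. (H $ j $ i)\<^sup>2)})"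
  have up: "J \<in> B" if I: "I \<in> B" and IJ: "I \<subseteq> J" for I J
  proof -
    have "sub_norm H I I \<le> sub_norm H J J" by (rule sub_norm_mono[OF IJ IJ])
    moreover have "(\<Sum>i\<in>I. (H $ j $ i)\<^sup>2) \<le> (\<Sum>i\<in>J. (H $ j $ i)\<^sup>2)" for j
      using IJ by (intro sum_mono2) auto
    ultimately show ?thesis using I unfolding B_def by (auto intro: less_le_trans)
  qed
  have "PE p UNIV (\<lambda>I. of_bool (I \<in> B))
    \<le> PE p UNIV (\<lambda>I. of_bool (1 / 2 < sub_norm H I I) + (\<Sum>j\<in>UNIV. of_bool (1 / (16 * L) < (\<Sum>i\<in>I. (H $ j $ i)\<^sup>2))))"
  proof (rule PE_mono)
    fix I
    show "of_bool (I \<in> B) \<le> of_bool (1 / 2 < sub_norm H I I)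
      + (\<Sum>j\<in>UNIV. of_bool (1 / (16 * L) < (\<Sum>i\<in>I. (H $ j $ i)\<^sup>2)) :: real)"
    proof (cases "\<exists>j. 1 / (16 * L) < (\<Sum>i\<in>I. (H $ j $ i)\<^sup>2)")
      case True
      then obtain j where j: "1 / (16 * L) < (\<Sum>i\<in>I. (H $ j $ i)\<^sup>2)" by blast
      have "of_bool (1 / (16 * L) < (\<Sum>i\<in>I. (H $ j $ i)\<^sup>2))
        \<le> (\<Sum>j\<in>UNIV. of_bool (1 / (16 * L) < (\<Sum>i\<in>I. (H $ j $ i)\<^sup>2)) :: real)"
        by (rule member_le_sum) auto
      then have "1 \<le> (\<Sum>j\<in>UNIV. of_bool (1 / (16 * L) < (\<Sum>i\<in>I. (H $ j $ i)\<^sup>2)) :: real)"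
        using j by (simp only: of_bool_eq if_True)
      moreover have "of_bool (I \<in> B) \<le> (1::real)" "(0::real) \<le> of_bool (1 / 2 < sub_norm H I I)" by simp_all
      ultimately show ?thesis by linarith
    next
      case False
      then have "I \<in> B \<longrightarrow> 1 / 2 < sub_norm H I I" unfolding B_def by blast
      then have "of_bool (I \<in> B) \<le> (of_bool (1 / 2 < sub_norm H I I) :: real)" by (rule of_bool_mono)
      moreover have "0 \<le> (\<Sum>j\<in>UNIV. of_bool (1 / (16 * L) < (\<Sum>i\<in>I. (H $ j $ i)\<^sup>2)) :: real)"
        by (intro sum_nonneg) simp
      ultimately show ?thesis by linarith
    qed
  qed (simp_all add: p_ge_0 p_le_1)
  \<comment> \<open>The rows contribute \<open>exp (- L)\<close> each, which raises 17.5 to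
    18.5.\<close>
  also have "\<dots> \<le> 17.5 * K * exp (- L) + (\<Sum>j\<in>(UNIV::'k set). exp (- L))"
    unfolding PE_add PE_sum
  proof (intro add_mono sum_mono)
    show "PE p UNIV (\<lambda>I. of_bool (1 / 2 < sub_norm H I I)) \<le> 17.5 * K * exp (- L)"
      unfolding K_def by (rule principal_submatrix_tail)
    show "PE p UNIV (\<lambda>I. of_bool (1 / (16 * L) < (\<Sum>i\<in>I. (H $ j $ i)\<^sup>2))) \<le> exp (- L)" for j
      using row_tail[of 1 j] by simp
  qed
  also have "\<dots> = 18.5 * K * exp (- L)" unfolding K_def by (simp add: algebra_simps)
  finally have PB: "PE p UNIV (\<lambda>I. of_bool (I \<in> B)) \<le> 18.5 * K * exp (- L)" .
  have RB: "measure_pmf.prob (rejective_sampling p S) B \<le> 10 * (18.5 * K * exp (- L))"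
  proof -
    have "measure_pmf.prob (rejective_sampling p S) B \<le> 10 * PE p UNIV (\<lambda>I. of_bool (I \<in> B))"
      by (intro rejective_prob_le p_ge_0 p_le_1 sum_p) (rule up)
    with PB show ?thesis by linarith
  qed
  let ?fail = "\<lambda>I \<sigma>. \<not> bp_recovers \<Phi> (signal \<Phi> S c \<sigma> (\<iota> I)) (coefficients S c \<sigma> (\<iota> I))"
  have "measure_pmf.prob (signal_model p S) {(I, \<sigma>). ?fail I \<sigma>}
    \<le> measure_pmf.prob (rejective_sampling p S) B + 2 * K * exp (- 2 * L)"
    unfolding signal_model_def
  proof (rule prob_pair_pmf_le)
    fix I assume I: "I \<in> set_pmf (rejective_sampling p S)" "I \<notin> B"
    have card: "card I = S"
      using I(1) set_cond_pmf[OF poisson_sampling_card_possible[OF p_ge_0 p_le_1 sum_p]]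
      unfolding rejective_sampling_def by auto
    have N: "sub_norm H I I \<le> 1 / 2" and r: "(\<Sum>i\<in>I. (H $ j $ i)\<^sup>2) \<le> 1 / (16 * L)" for j
      using I(2) unfolding B_def by (auto simp: not_less)
    show "measure_pmf.prob (rademacher_signs S) {\<sigma>. ?fail I \<sigma>} \<le> 2 * K * exp (- 2 * L)"
      unfolding K_def
    proof (rule bp_failure_prob_le)
      show "sub_norm (hollow_gram \<Phi>) I I \<le> 1 / 2" using N unfolding H_def .
      show "(\<Sum>i\<in>I. (hollow_gram \<Phi> $ j $ i)\<^sup>2) \<le> 1 / (16 * L)" for j using r unfolding H_def .
      show "0 < L" using L1 by simp
      show "bij_betw (\<iota> I) {1..S} I" by (rule enum[OF card])
    qed (rule c_pos)
  qed (use K1 in simp)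
  \<comment> \<open>Here \<open>exp (- 2 * L) \<le> exp (- L)\<close>, and the constants add up to
    \<open>185 + 2 = 187\<close>, below 220.\<close>
  also have "\<dots> \<le> 10 * (18.5 * K * exp (- L)) + 2 * K * exp (- L)"
    using RB K1 L1 by (intro add_mono mult_left_mono) auto
  also have "\<dots> \<le> 220 * K * exp (- L)" using K1 by simp
  also have "\<dots> = \<epsilon>" unfolding eL using K1 by simp
  finally have fail: "measure_pmf.prob (signal_model p S) {(I, \<sigma>). ?fail I \<sigma>} \<le> \<epsilon>" .
  have "{(I, \<sigma>). bp_recovers \<Phi> (signal \<Phi> S c \<sigma> (\<iota> I)) (coefficients S c \<sigma> (\<iota> I))}
    = UNIV - {(I, \<sigma>). ?fail I \<sigma>}" by auto
  then show ?thesis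
    using fail measure_pmf.prob_compl[of "{(I, \<sigma>). ?fail I \<sigma>}" "signal_model p S"] by simp
qed

end
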